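(* Consider the online problem $\min_{x\in\mathbb{R}^d} f(x):=\mathbb{E}_{u\sim\mathbb{P}}[f_u(x)]$, and suppose that Assumptions (A1)--(A6) of the context hold, with $\sigma_{\min}<\sigma_{\max}$. Let $$\eta\equiv\frac{2\sigma_{\min}}{(1+\sqrt5)\,L\,\sigma_{\max}^2},\qquad \beta^*=\frac{\eta\sigma_{\min}}{2}-\frac{L\eta^2\sigma_{\max}^2}{2}-\frac{\eta^3\sigma_{\max}^3L^2}{2}.$$ Choose any desired accuracy $\epsilon>0$ and run the online SpiderSQN algorithm described in the context with step size $\eta$ and $$q=|\xi_k|=\sqrt{|\xi_0|}\equiv\sqrt{\Big(\frac{\eta\sigma_{\max}}{\beta^*}+2+\frac{L^2\eta^3\sigma_{\max}^3}{\beta^*}\Big)\frac{2\sigma_1^2}{\epsilon^2}}.$$ Then the output $x_\zeta$ satisfies $\mathbb{E}\|\nabla f(x_\zeta)\|\le\epsilon$ provided that the total number of iterations $K$ satisfies $$K\ge \mathcal{O}\Big(\frac{f(x_0)-f^*}{\epsilon^2}\Big).$$ Moreover, the SFO complexity is in the order of $\mathcal{O}(\epsilon^{-3})$.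
   Context: Norms are Euclidean for vectors and spectral for matrices; $A\preceq B$ means that $B-A$ is positive semidefinite. Assumptions. (A1) $f^*:=\inf_{x\in\mathbb{R}^d} f(x)>-\infty$. (A2) Each $f_u:\mathbb{R}^d\to\mathbb{R}$, $u\sim\mathbb{P}$, is $L$-smooth with $L>0$: $\|\nabla f_u(x)-\nabla f_u(y)\|\le L\|x-y\|$ for all $x,y$. (A3) Each $f_u$ is twice continuously differentiable and there is $\kappa>0$ with $\|\nabla^2 f_u(x)\|\le\kappa$ for all $x$ and $u$. (A4) There are constants $\sigma_{\min},\sigma_{\max}>0$ with $\sigma_{\min}I\preceq H_k\preceq\sigma_{\max}I$ for all $k$, where $H_k$ is the inverse Hessian approximation matrix used at iteration $k$. (A5) For $k\ge2$, $H_k$ depends only on $v_{k-1}$ and $\xi_k$, and $\mathbb{E}[H_kv_k\mid \xi_k,v_{k-1}]=H_kv_k$. (A6) $\nabla f_u(x)$ is an unbiased estimator of $\nabla f(x)$ and there is $\sigma_1>0$ such that $\mathbb{E}_{u\sim\mathbb{P}}\|\nabla f_u(x)-\nabla f(x)\|^2\le\sigma_1^2$ for all $x\in\mathbb{R}^d$. Online SpiderSQN algorithm. Start at $x_0\in\mathbb{R}^d$. For $k=0,\dots,K-1$: if $k\equiv0\pmod q$, draw $|\xi_0|$ fresh independent samples from $\mathbb{P}$ and let $v_k$ be the average of $\nabla f_u(x_k)$ over these samples; otherwise draw a batch $\xi_k$ of $|\xi_k|$ fresh independent samples from $\mathbb{P}$ and set $v_k=\nabla f_{\xi_k}(x_k)-\nabla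 f_{\xi_k}(x_{k-1})+v_{k-1}$, where $\nabla f_{\xi_k}(x)=\frac1{|\xi_k|}\sum_{u\in\xi_k}\nabla f_u(x)$. ($|\xi_0|$ is the batch size at the iterations divisible by $q$, $|\xi_k|$ the constant batch size at all others.) Compute $d_k=H_kv_k$ by SdLBFGS (below) and set $x_{k+1}=x_k-\eta d_k$. The output is $x_\zeta$ with $\zeta$ uniformly distributed on $\{1,\dots,K\}$. SdLBFGS (stochastic damped L-BFGS, memory size $m$, constant $\delta>0$). For $k\ge1$ put $s_{k-1}=x_k-x_{k-1}$, $\bar y_{k-1}=v_k-v_{k-1}$, $\gamma_k=\max\{\bar y_{k-1}^\top\bar y_{k-1}/(s_{k-1}^\top\bar y_{k-1}),\delta\}$, $H_{k,0}=\gamma_k^{-1}I$, $\sigma_{k-1}=s_{k-1}^\top H_{k,0}^{-1}s_{k-1}$, $\theta_{k-1}=\frac{0.75\sigma_{k-1}}{\sigma_{k-1}-s_{k-1}^\top\bar y_{k-1}}$ if $s_{k-1}^\top\bar y_{k-1}<0.25\sigma_{k-1}$ and $\theta_{k-1}=1$ otherwise, $\hat y_{k-1}=\theta_{k-1}\bar y_{k-1}+(1-\theta_{k-1})H_{k,0}^{-1}s_{k-1}$, $\rho_{k-1}=(s_{k-1}^\top\hat y_{k-1})^{-1}$. Starting from $H_{k,0}$, $H_k$ is obtained by applying, successively for the (at most $m$) most recent indices $j=k-m,\dots,k-1$ with $j\ge0$, the update $H\mapsto (I-\rho_js_j\hat y_j^\top)H(I-\rho_j\hat y_js_j^\top)+\rho_js_js_j^\top$.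 For $k=0$ there are no pairs and $H_0=H_{0,0}=\gamma_0^{-1}I$. An SFO (stochastic first-order oracle) call takes a sample $u$ and a point $x$ and returns $(f_u(x),\nabla f_u(x))$; the SFO complexity is the total number of such calls. Integer rounding is suppressed. "$K\ge\mathcal{O}(A)$" means: there is a constant $C>0$ depending only on $L,\sigma_{\min},\sigma_{\max}$ such that $K\ge CA$ suffices. The SFO complexity refers to $K$ taken of this order, as $\epsilon\to0$; the hidden constant may depend on $L,\sigma_{\min},\sigma_{\max},\sigma_1$ and $f(x_0)-f^*$, but not on $\epsilon$. *)

theory Defs
  imports "HOL-Probability.Probability" "HOL-Library.Landau_Symbols"
begin

section \<open>Gradients, Hessians, Loewner order\<close>

definition grad :: "('a::real_inner \<Rightarrow> real) \<Rightarrow> 'a \<Rightarrow> 'a" where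
  "grad f x = (THE g. GDERIV f x :> g)"

definition hessian :: "(real^'n \<Rightarrow> real) \<Rightarrow> real^'n \<Rightarrow> real^'n^'n" where
  "hessian f x = matrix (frechet_derivative (grad f) (at x))"

definition twice_cont_diff :: "(real^'n \<Rightarrow> real) \<Rightarrow> bool" where
  "twice_cont_diff f \<longleftrightarrow>
     (\<forall>x. f differentiable (at x)) \<and> (\<forall>x. grad f differentiable (at x)) \<and>
     continuous_on UNIV (hessian f)"

definition L_smooth :: "real \<Rightarrow> ('a::real_inner \<Rightarrow> real) \<Rightarrow> bool" where
  "L_smooth L f \<longleftrightarrow>
     (\<forall>x. f differentiable (at x)) \<and> (\<forall>x y. norm (grad f x - grad f y) \<le> L * norm (x - y))"

definition spectral_norm :: "real^'n^'m \<Rightarrow> real" where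
  "spectral_norm A = onorm (\<lambda>z. A *v z)"

definition pos_semidef :: "real^'n^'n \<Rightarrow> bool" where
  "pos_semidef A \<longleftrightarrow> transpose A = A \<and> (\<forall>z. 0 \<le> z \<bullet> (A *v z))"

definition loewner_le :: "real^'n^'n \<Rightarrow> real^'n^'n \<Rightarrow> bool" where
  "loewner_le A B \<longleftrightarrow> pos_semidef (B - A)"

definition outer :: "real^'n \<Rightarrow> real^'m \<Rightarrow> real^'m^'n" where
  "outer a b = (\<chi> i j. a $ i * b $ j)"


section \<open>The online problem\<close>

definition objective :: "'u measure \<Rightarrow> ('u \<Rightarrow> real^'n \<Rightarrow> real) \<Rightarrow> real^'n \<Rightarrow> real" where
  "objective P F x = (\<integral>u. F u x \<partial>P)"

text \<open>The integrability conditions ensure that no expectation below is the default value \<open>0\<close> of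
  the Bochner integral of a non-integrable function.\<close>

locale online_problem = prob_space P
  for P :: "'u measure" and F :: "'u \<Rightarrow> real^'n \<Rightarrow> real" and L \<kappa> \<sigma>1 :: real +
  assumes L_pos: "0 < L" and \<kappa>_pos: "0 < \<kappa>" and \<sigma>1_pos: "0 < \<sigma>1"
    and integrable_F: "\<And>x. integrable P (\<lambda>u. F u x)"
    and bounded_below: "bdd_below (range (objective P F))"
    and smooth: "\<And>u. u \<in> space P \<Longrightarrow> L_smooth L (F u)"
    and twice_diff: "\<And>u. u \<in> space P \<Longrightarrow> twice_cont_diff (F u)"
    and hessian_bound: "\<And>u x. u \<in> space P \<Longrightarrow> spectral_norm (hessian (F u) x) \<le> \<kappa>"
    and objective_diff: "\<And>x. objective P F differentiable (at x)"
    and integrable_grad: "\<And>x. integrable P (\<lambda>u. grad (F u) x)"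
    and unbiased: "\<And>x. (\<integral>u. grad (F u) x \<partial>P) = grad (objective P F) x"
    and integrable_variance:
      "\<And>x. integrable P (\<lambda>u. (norm (grad (F u) x - grad (objective P F) x))\<^sup>2)"
    and variance_bound:
      "\<And>x. (\<integral>u. (norm (grad (F u) x - grad (objective P F) x))\<^sup>2 \<partial>P) \<le> \<sigma>1\<^sup>2"


section \<open>Stochastic damped L-BFGS\<close>

text \<open>The arguments \<open>x\<close> and \<open>v\<close> are the sequences of iterates and of gradient estimators (of one
  realization); the matrix at iteration \<open>k\<close> uses them only up to index \<open>k\<close>. The subscript \<open>j\<close> of
  the correction pairs corresponds to the step from \<open>j\<close> to \<open>j + 1\<close>. The number \<open>\<gamma>\<^sub>0\<close>, for which there
  is no pair, is the parameter \<open>\<gamma>0\<close>. Since \<open>a / 0 = 0\<close>, a step with \<open>s \<bullet> y = 0\<close> has \<open>\<gamma> = \<delta>\<close> when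
  \<open>0 < \<delta>\<close>, and a step with \<open>s = 0\<close> has \<open>\<rho> = 0\<close>, so that it leaves the matrix unchanged.\<close>

definition sdl_s :: "(nat \<Rightarrow> real^'n) \<Rightarrow> nat \<Rightarrow> real^'n" where
  "sdl_s x j = x (Suc j) - x j"

definition sdl_ybar :: "(nat \<Rightarrow> real^'n) \<Rightarrow> nat \<Rightarrow> real^'n" where
  "sdl_ybar v j = v (Suc j) - v j"

definition sdl_gamma ::
  "real \<Rightarrow> real \<Rightarrow> (nat \<Rightarrow> real^'n) \<Rightarrow> (nat \<Rightarrow> real^'n) \<Rightarrow> nat \<Rightarrow> real" where
  "sdl_gamma \<delta> \<gamma>0 x v k = (case k of 0 \<Rightarrow> \<gamma>0 | Suc j \<Rightarrow>
     max ((sdl_ybar v j \<bullet> sdl_ybar v j) / (sdl_s x j \<bullet> sdl_ybar v j)) \<delta>)"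

text \<open>Initial matrix at iteration \<open>k\<close>, and its inverse.\<close>

definition sdl_H0 ::
  "real \<Rightarrow> real \<Rightarrow> (nat \<Rightarrow> real^'n) \<Rightarrow> (nat \<Rightarrow> real^'n) \<Rightarrow> nat \<Rightarrow> real^'n^'n" where
  "sdl_H0 \<delta> \<gamma>0 x v k = mat (1 / sdl_gamma \<delta> \<gamma>0 x v k)"

definition sdl_H0_inv ::
  "real \<Rightarrow> real \<Rightarrow> (nat \<Rightarrow> real^'n) \<Rightarrow> (nat \<Rightarrow> real^'n) \<Rightarrow> nat \<Rightarrow> real^'n^'n" where
  "sdl_H0_inv \<delta> \<gamma>0 x v k = mat (sdl_gamma \<delta> \<gamma>0 x v k)"

definition sdl_sigma ::
  "real \<Rightarrow> real \<Rightarrow> (nat \<Rightarrow> real^'n) \<Rightarrow> (nat \<Rightarrow> real^'n) \<Rightarrow> nat \<Rightarrow> real" where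
  "sdl_sigma \<delta> \<gamma>0 x v j = sdl_s x j \<bullet> (sdl_H0_inv \<delta> \<gamma>0 x v (Suc j) *v sdl_s x j)"

definition sdl_theta ::
  "real \<Rightarrow> real \<Rightarrow> (nat \<Rightarrow> real^'n) \<Rightarrow> (nat \<Rightarrow> real^'n) \<Rightarrow> nat \<Rightarrow> real" where
  "sdl_theta \<delta> \<gamma>0 x v j =
     (if sdl_s x j \<bullet> sdl_ybar v j < 0.25 * sdl_sigma \<delta> \<gamma>0 x v j
      then 0.75 * sdl_sigma \<delta> \<gamma>0 x v j / (sdl_sigma \<delta> \<gamma>0 x v j - sdl_s x j \<bullet> sdl_ybar v j)
      else 1)"

definition sdl_yhat ::
  "real \<Rightarrow> real \<Rightarrow> (nat \<Rightarrow> real^'n) \<Rightarrow> (nat \<Rightarrow> real^'n) \<Rightarrow> nat \<Rightarrow> real^'n" where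
  "sdl_yhat \<delta> \<gamma>0 x v j =
     sdl_theta \<delta> \<gamma>0 x v j *\<^sub>R sdl_ybar v j
     + (1 - sdl_theta \<delta> \<gamma>0 x v j) *\<^sub>R (sdl_H0_inv \<delta> \<gamma>0 x v (Suc j) *v sdl_s x j)"

definition sdl_rho ::
  "real \<Rightarrow> real \<Rightarrow> (nat \<Rightarrow> real^'n) \<Rightarrow> (nat \<Rightarrow> real^'n) \<Rightarrow> nat \<Rightarrow> real" where
  "sdl_rho \<delta> \<gamma>0 x v j = 1 / (sdl_s x j \<bullet> sdl_yhat \<delta> \<gamma>0 x v j)"

definition sdl_update ::
  "real \<Rightarrow> real \<Rightarrow> (nat \<Rightarrow> real^'n) \<Rightarrow> (nat \<Rightarrow> real^'n) \<Rightarrow> nat \<Rightarrow> real^'n^'n \<Rightarrow> real^'n^'n" where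
  "sdl_update \<delta> \<gamma>0 x v j H =
     (mat 1 - sdl_rho \<delta> \<gamma>0 x v j *\<^sub>R outer (sdl_s x j) (sdl_yhat \<delta> \<gamma>0 x v j))
     ** H
     ** (mat 1 - sdl_rho \<delta> \<gamma>0 x v j *\<^sub>R outer (sdl_yhat \<delta> \<gamma>0 x v j) (sdl_s x j))
     + sdl_rho \<delta> \<gamma>0 x v j *\<^sub>R outer (sdl_s x j) (sdl_s x j)"

text \<open>Truncated subtraction: for \<open>k < m\<close> all pairs \<open>0, \<dots>, k - 1\<close> are used.\<close>

definition sdlbfgs ::
  "nat \<Rightarrow> real \<Rightarrow> real \<Rightarrow> (nat \<Rightarrow> real^'n) \<Rightarrow> (nat \<Rightarrow> real^'n) \<Rightarrow> nat \<Rightarrow> real^'n^'n" where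
  "sdlbfgs m \<delta> \<gamma>0 x v k = fold (sdl_update \<delta> \<gamma>0 x v) [k - m..<k] (sdl_H0 \<delta> \<gamma>0 x v k)"


section \<open>Online SpiderSQN\<close>

text \<open>\<open>b0\<close> is the batch size at the iterations divisible by \<open>q\<close>, \<open>b\<close> the one at all others.\<close>

definition batch_size :: "nat \<Rightarrow> nat \<Rightarrow> nat \<Rightarrow> nat \<Rightarrow> nat" where
  "batch_size q b0 b k = (if q dvd k then b0 else b)"

definition batch_grad ::
  "('u \<Rightarrow> real^'n \<Rightarrow> real) \<Rightarrow> nat \<Rightarrow> (nat \<Rightarrow> 'u) \<Rightarrow> real^'n \<Rightarrow> real^'n" where
  "batch_grad F b \<xi> x = (1 / real b) *\<^sub>R (\<Sum>i<b. grad (F (\<xi> i)) x)"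

definition sample_index :: "nat \<Rightarrow> nat \<Rightarrow> nat \<Rightarrow> nat \<Rightarrow> (nat \<times> nat) set" where
  "sample_index q b0 b K = (SIGMA k:{..<K}. {..<batch_size q b0 b k})"

definition hess_approx ::
  "nat \<Rightarrow> real \<Rightarrow> real \<Rightarrow> (nat \<Rightarrow> 'w \<Rightarrow> real^'n) \<Rightarrow> (nat \<Rightarrow> 'w \<Rightarrow> real^'n) \<Rightarrow>
   nat \<Rightarrow> 'w \<Rightarrow> real^'n^'n" where
  "hess_approx m \<delta> \<gamma>0 x v k \<omega> = sdlbfgs m \<delta> \<gamma>0 (\<lambda>j. x j \<omega>) (\<lambda>j. v j \<omega>) k"

text \<open>A run with \<open>K\<close> iterations on a probability space \<open>M\<close>: \<open>U k i\<close> is the \<open>i\<close>-th sample drawn at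
  iteration \<open>k\<close>, and \<open>\<zeta>\<close> the random index of the output. The equations determine
  \<open>x 0, \<dots>, x K\<close> and \<open>v 0, \<dots>, v (K - 1)\<close>; the sequences are arbitrary beyond.\<close>

locale spider_sqn_run = prob_space M
  for M :: "'w measure" and P :: "'u measure" and F :: "'u \<Rightarrow> real^'n \<Rightarrow> real"
    and x0 :: "real^'n" and \<eta> :: real and q b0 b :: nat
    and m :: nat and \<delta> \<gamma>0 :: real and K :: nat
    and U :: "nat \<Rightarrow> nat \<Rightarrow> 'w \<Rightarrow> 'u" and \<zeta> :: "'w \<Rightarrow> nat"
    and x v :: "nat \<Rightarrow> 'w \<Rightarrow> real^'n" +
  assumes samples_indep:
      "indep_vars (\<lambda>_. P) (\<lambda>p. U (fst p) (snd p)) (sample_index q b0 b K)"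
    and samples_distr:
      "\<And>k i. (k, i) \<in> sample_index q b0 b K \<Longrightarrow> distr M P (U k i) = P"
    and output_measurable: "\<zeta> \<in> measurable M (count_space {1..K})"
    and output_distr:
      "distr M (count_space {1..K}) \<zeta> = uniform_count_measure {1..K}"
    and output_indep:
      "indep_set
         (sets (vimage_algebra (space M)
            (\<lambda>\<omega>. \<lambda>p\<in>sample_index q b0 b K. U (fst p) (snd p) \<omega>)
            (PiM (sample_index q b0 b K) (\<lambda>_. P))))
         (sets (vimage_algebra (space M) \<zeta> (count_space {1..K})))"
    and x_init: "\<And>\<omega>. \<omega> \<in> space M \<Longrightarrow> x 0 \<omega> = x0"
    and v_restart:
      "\<And>k \<omega>. k < K \<Longrightarrow> q dvd k \<Longrightarrow> \<omega> \<in> space M \<Longrightarrow>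
         v k \<omega> = batch_grad F b0 (\<lambda>i. U k i \<omega>) (x k \<omega>)"
    and v_recursive:
      "\<And>k \<omega>. k < K \<Longrightarrow> \<not> q dvd k \<Longrightarrow> \<omega> \<in> space M \<Longrightarrow>
         v k \<omega> = batch_grad F b (\<lambda>i. U k i \<omega>) (x k \<omega>)
                - batch_grad F b (\<lambda>i. U k i \<omega>) (x (k - 1) \<omega>) + v (k - 1) \<omega>"
    and x_step:
      "\<And>k \<omega>. k < K \<Longrightarrow> \<omega> \<in> space M \<Longrightarrow>
         x (Suc k) \<omega> = x k \<omega> - \<eta> *\<^sub>R (hess_approx m \<delta> \<gamma>0 x v k \<omega> *v v k \<omega>)"

definition hess_approx_bounded ::
  "'w measure \<Rightarrow> real \<Rightarrow> real \<Rightarrow> nat \<Rightarrow> real \<Rightarrow> real \<Rightarrow> nat \<Rightarrow>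
   (nat \<Rightarrow> 'w \<Rightarrow> real^'n) \<Rightarrow> (nat \<Rightarrow> 'w \<Rightarrow> real^'n) \<Rightarrow> bool" where
  "hess_approx_bounded M smin smax m \<delta> \<gamma>0 K x v \<longleftrightarrow>
     (\<forall>k<K. AE \<omega> in M.
        loewner_le (mat smin) (hess_approx m \<delta> \<gamma>0 x v k \<omega>) \<and>
        loewner_le (hess_approx m \<delta> \<gamma>0 x v k \<omega>) (mat smax))"

text \<open>The pair of \<open>v (k - 1)\<close> and the batch of iteration \<open>k\<close>, the space in which it takes values, and
  the sigma-algebra that it generates. The conditional expectation of the random vector
  \<open>H\<^sub>k v\<^sub>k\<close> is taken componentwise.\<close>

definition cond_space :: "'u measure \<Rightarrow> nat \<Rightarrow> ((real^'n) \<times> (nat \<Rightarrow> 'u)) measure" where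
  "cond_space P n = borel \<Otimes>\<^sub>M PiM {..<n} (\<lambda>_. P)"

definition cond_var ::
  "nat \<Rightarrow> (nat \<Rightarrow> nat \<Rightarrow> 'w \<Rightarrow> 'u) \<Rightarrow> (nat \<Rightarrow> 'w \<Rightarrow> real^'n) \<Rightarrow> nat \<Rightarrow>
   'w \<Rightarrow> (real^'n) \<times> (nat \<Rightarrow> 'u)" where
  "cond_var n U v k \<omega> = (v (k - 1) \<omega>, \<lambda>i\<in>{..<n}. U k i \<omega>)"

definition hess_approx_dependence ::
  "'w measure \<Rightarrow> 'u measure \<Rightarrow> nat \<Rightarrow> nat \<Rightarrow> nat \<Rightarrow> nat \<Rightarrow> real \<Rightarrow> real \<Rightarrow> nat \<Rightarrow>
   (nat \<Rightarrow> nat \<Rightarrow> 'w \<Rightarrow> 'u) \<Rightarrow> (nat \<Rightarrow> 'w \<Rightarrow> real^'n) \<Rightarrow> (nat \<Rightarrow> 'w \<Rightarrow> real^'n) \<Rightarrow> bool" where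
  "hess_approx_dependence M P q b0 b m \<delta> \<gamma>0 K U x v \<longleftrightarrow>
     (\<forall>k. 2 \<le> k \<and> k < K \<longrightarrow>
       (let n = batch_size q b0 b k;
            H = hess_approx m \<delta> \<gamma>0 x v k;
            G = vimage_algebra (space M) (cond_var n U v k) (cond_space P n)
        in (\<exists>h. h \<in> borel_measurable (cond_space P n) \<and>
                (AE \<omega> in M. H \<omega> = h (cond_var n U v k \<omega>))) \<and>
           (\<forall>i. AE \<omega> in M.
                real_cond_exp M G (\<lambda>\<omega>. (H \<omega> *v v k \<omega>) $ i) \<omega> = (H \<omega> *v v k \<omega>) $ i)))"

text \<open>Every sample of a restart iteration is queried at \<open>x k\<close> only, every sample of another
  iteration at both \<open>x k\<close> and \<open>x (k - 1)\<close>.\<close>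

definition sfo_calls :: "nat \<Rightarrow> nat \<Rightarrow> nat \<Rightarrow> nat \<Rightarrow> nat" where
  "sfo_calls q b0 b K = (\<Sum>k<K. if q dvd k then b0 else 2 * b)"


section \<open>Parameters\<close>

definition step_size :: "real \<Rightarrow> real \<Rightarrow> real \<Rightarrow> real" where
  "step_size L smin smax = 2 * smin / ((1 + sqrt 5) * L * smax\<^sup>2)"

definition beta_star :: "real \<Rightarrow> real \<Rightarrow> real \<Rightarrow> real" where
  "beta_star L smin smax =
     (let \<eta> = step_size L smin smax
      in \<eta> * smin / 2 - L * \<eta>\<^sup>2 * smax\<^sup>2 / 2 - \<eta>^3 * smax^3 * L\<^sup>2 / 2)"

text \<open>The epoch length, rounded up; the batch sizes will be its square and itself.\<close>

definition epoch_length :: "real \<Rightarrow> real \<Rightarrow> real \<Rightarrow> real \<Rightarrow> real \<Rightarrow> nat" where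
  "epoch_length L smin smax \<sigma>1 \<epsilon> =
     (let \<eta> = step_size L smin smax; \<beta> = beta_star L smin smax
      in nat \<lceil>sqrt ((\<eta> * smax / \<beta> + 2 + L\<^sup>2 * \<eta>^3 * smax^3 / \<beta>) * (2 * \<sigma>1\<^sup>2 / \<epsilon>\<^sup>2))\<rceil>)"

text \<open>The constant hidden in the order of the required number of iterations. It is given as a
  function of \<open>L\<close> and of the bounds on the matrices, rather than by an existential quantifier in
  the theorem, because the latter could not range over the type variables and would therefore
  allow the constant to depend on the dimension and on the type of the samples.\<close>

definition iteration_const :: "real \<Rightarrow> real \<Rightarrow> real \<Rightarrow> real" where
  "iteration_const L smin smax =
     4 * (1 + L\<^sup>2 * (step_size L smin smax)\<^sup>2 * smax\<^sup>2) / beta_star L smin smax"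

end

theory Submission
  imports Defs
begin

text \<open>Let \<open>g\<^sub>k = \<nabla>f(x\<^sub>k)\<close>, \<open>e\<^sub>k = E\<parallel>v\<^sub>k - g\<^sub>k\<parallel>\<^sup>2\<close>, \<open>V\<^sub>k = E\<parallel>v\<^sub>k\<parallel>\<^sup>2\<close>, \<open>G\<^sub>k = E\<parallel>g\<^sub>k\<parallel>\<^sup>2\<close> and
  \<open>\<alpha> = L\<^sup>2\<eta>\<^sup>2\<sigma>\<^sub>m\<^sub>a\<^sub>x\<^sup>2\<close>. The samples of iteration \<open>k\<close> are independent of the past, so the estimator error
  is a martingale within an epoch: \<open>e\<^sub>k \<le> e\<^sub>k\<^sub>-\<^sub>1 + (\<alpha>/q) V\<^sub>k\<^sub>-\<^sub>1\<close>, with \<open>e\<^sub>k \<le> \<sigma>\<^sub>1\<^sup>2/q\<^sup>2\<close> at a restart.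
  Summed over epochs of length \<open>q\<close> this gives \<open>\<Sum> e\<^sub>k \<le> K\<sigma>\<^sub>1\<^sup>2/q\<^sup>2 + \<alpha> \<Sum> V\<^sub>k\<close>, and inserting it into the
  descent inequality of a quasi-Newton step leaves
  \<open>(\<eta>\<sigma>\<^sub>m\<^sub>i\<^sub>n/2) \<Sum> G\<^sub>k + \<beta>\<^sup>* \<Sum> V\<^sub>k \<le> f(x\<^sub>0) - f\<^sup>* + K\<eta>\<sigma>\<^sub>m\<^sub>a\<^sub>x\<sigma>\<^sub>1\<^sup>2/(2q\<^sup>2) \<le> K\<beta>\<^sup>*\<epsilon>\<^sup>2/2\<close>. Since
  \<open>\<beta>\<^sup>* \<le> \<eta>\<sigma>\<^sub>m\<^sub>i\<^sub>n/2\<close>, \<open>\<alpha> \<le> 1\<close> and \<open>G\<^sub>k\<^sub>+\<^sub>1 \<le> 2G\<^sub>k + 2\<alpha>V\<^sub>k\<close>, the average of \<open>G\<^sub>1, \<dots>, G\<^sub>K\<close> is at most \<open>\<epsilon>\<^sup>2\<close>.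
  All expectations are nonnegative integrals, so integrability never has to be assumed; finiteness
  follows along the same inequalities.\<close>

section \<open>One quasi-Newton step\<close>

text \<open>\<open>grad\<close> is a definite description, so existence and uniqueness both have to
  be shown: a linear functional is represented by the vector built from its values on the basis, and
  derivatives are unique.\<close>

lemma GDERIV_grad:
  fixes f :: "'a::euclidean_space \<Rightarrow> real"
  assumes "f differentiable (at x)"
  shows "GDERIV f x :> grad f x"
proof -
  obtain f' where f': "(f has_derivative f') (at x)"
    using assms by (auto simp: differentiable_def)
  interpret bounded_linear f' using f' by (rule has_derivative_bounded_linear)
  define g where "g = (\<Sum>b\<in>Basis. f' b *\<^sub>R b)"
  have "f' h = h \<bullet> g" for h
  proof -
    have "f' h = f' (\<Sum>b\<in>Basis. (h \<bullet> b) *\<^sub>R b)" by (simp add: euclidean_representation)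
    also have "\<dots> = (\<Sum>b\<in>Basis. (h \<bullet> b) * f' b)" by (simp add: sum scaleR)
    also have "\<dots> = h \<bullet> g" by (simp add: g_def inner_sum_right mult.commute)
    finally show ?thesis .
  qed
  then have f'_eq: "f' = (\<lambda>h. h \<bullet> g)" by auto
  then have g: "GDERIV f x :> g" using f' by (simp add: gderiv_def)
  moreover have "g' = g" if "GDERIV f x :> g'" for g'
  proof -
    have "(\<lambda>h. h \<bullet> g') = (\<lambda>h. h \<bullet> g)"
      using that g unfolding gderiv_def by (rule has_derivative_unique)
    then show ?thesis by (metis vector_eq_ldot)
  qed
  ultimately show ?thesis unfolding grad_def by (rule theI)
qed

text \<open>The descent lemma, proved without integration: up to a constant, \<open>\<phi>\<close>
  is the function along the segment minus its quadratic majorant, and the Lipschitz bound makes its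
  derivative nonpositive.\<close>

lemma L_smooth_upper_bound:
  fixes f :: "'a::euclidean_space \<Rightarrow> real"
  assumes "L_smooth L f"
  shows "f y \<le> f x + grad f x \<bullet> (y - x) + L / 2 * (norm (y - x))\<^sup>2"
proof -
  define d where "d = y - x"
  define \<phi> where "\<phi> t = f (x + t *\<^sub>R d) - t * (grad f x \<bullet> d) - L * t\<^sup>2 / 2 * (norm d)\<^sup>2" for t
  define \<phi>' where
    "\<phi>' t = grad f (x + t *\<^sub>R d) \<bullet> d - grad f x \<bullet> d - L * t * (norm d)\<^sup>2" for t
  have deriv: "(\<phi> has_real_derivative \<phi>' t) (at t)" for t
  proof -
    have f: "(f has_derivative (\<lambda>h. h \<bullet> grad f (x + t *\<^sub>R d))) (at (x + t *\<^sub>R d))"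
      using GDERIV_grad assms by (auto simp: L_smooth_def gderiv_def)
    have line: "((\<lambda>t. x + t *\<^sub>R d) has_derivative (\<lambda>h. h *\<^sub>R d)) (at t)"
      by (auto intro!: derivative_eq_intros)
    have "((\<lambda>t. f (x + t *\<^sub>R d)) has_real_derivative grad f (x + t *\<^sub>R d) \<bullet> d) (at t)"
      unfolding has_field_derivative_def
      by (rule has_derivative_eq_rhs[OF has_derivative_compose[OF line f]])
        (simp add: fun_eq_iff inner_commute mult.commute)
    then show ?thesis
      unfolding \<phi>_def \<phi>'_def by (auto intro!: derivative_eq_intros)
  qed
  have "\<phi>' t \<le> 0" if "0 \<le> t" for t
  proof -
    have "grad f (x + t *\<^sub>R d) \<bullet> d - grad f x \<bullet> d
        \<le> norm (grad f (x + t *\<^sub>R d) - grad f x) * norm d"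
      by (simp add: norm_cauchy_schwarz flip: inner_diff_left)
    also have "\<dots> \<le> L * norm (t *\<^sub>R d) * norm d"
      using assms unfolding L_smooth_def
      by (metis add_diff_cancel_left' mult_right_mono norm_ge_zero)
    finally show ?thesis using that by (simp add: \<phi>'_def power2_eq_square algebra_simps)
  qed
  then have "\<phi> 1 \<le> \<phi> 0"
    using deriv by (intro DERIV_nonpos_imp_nonincreasing[of 0 1 \<phi>]) auto
  then show ?thesis by (simp add: \<phi>_def d_def)
qed

lemma mat_matrix_vector_mult:
  fixes z :: "real^'n"
  shows "mat s *v z = s *\<^sub>R z"
  by (simp add: vec_eq_iff matrix_vector_mult_def mat_def if_distrib if_distribR sum.delta' cong: if_cong)

text \<open>Symmetry is part of \<open>pos_semidef\<close>; since \<open>mat s\<close> is symmetric,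
  \<open>A\<close> inherits it, which later justifies moving \<open>A\<close> across inner
  products.\<close>

lemma loewner_le_mat_left:
  assumes "loewner_le (mat s) A"
  shows "transpose A = A" "s * (z \<bullet> z) \<le> z \<bullet> (A *v z)"
proof -
  have sym: "transpose (A - mat s) = A - mat s"
    and pos: "0 \<le> z \<bullet> ((A - mat s) *v z)"
    using assms by (auto simp: loewner_le_def pos_semidef_def)
  have "A $ j $ i = A $ i $ j" for i j
  proof -
    have "transpose (A - mat s) $ i $ j = (A - mat s) $ i $ j" using sym by simp
    then show ?thesis by (auto simp: transpose_def mat_def split: if_splits)
  qed
  then show "transpose A = A" by (simp add: transpose_def vec_eq_iff)
  then show "s * (z \<bullet> z) \<le> z \<bullet> (A *v z)"
    using pos by (simp add: matrix_vector_mult_diff_rdistrib mat_matrix_vector_mult inner_diff_right)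
qed

lemma loewner_le_mat_right:
  assumes "loewner_le A (mat s)"
  shows "z \<bullet> (A *v z) \<le> s * (z \<bullet> z)"
proof -
  have pos: "0 \<le> z \<bullet> ((mat s - A) *v z)"
    using assms by (auto simp: loewner_le_def pos_semidef_def)
  then show ?thesis
    using pos by (simp add: matrix_vector_mult_diff_rdistrib mat_matrix_vector_mult inner_diff_right)
qed

lemma inner_matrix_vector_sym:
  fixes A :: "real^'n^'n"
  assumes "transpose A = A"
  shows "y \<bullet> (A *v z) = z \<bullet> (A *v y)"
  by (metis assms dot_lmul_matrix inner_commute vector_transpose_matrix)

text \<open>No eigenvalues are used: nonnegativity of the quadratic form of \<open>A\<close> is
  tested at \<open>z = v - (1 / s) *\<^sub>R w\<close> with \<open>w = A *v v\<close>, and the upper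
  bound is applied both at \<open>v\<close> and at \<open>w\<close>. What remains is
  \<open>0 \<le> s * (v \<bullet> v) - (w \<bullet> w) / s\<close>.\<close>

lemma loewner_bounds_norm:
  fixes A :: "real^'n^'n"
  assumes lower: "loewner_le (mat a) A" and upper: "loewner_le A (mat s)" and "0 \<le> a" "0 < s"
  shows "(norm (A *v v))\<^sup>2 \<le> s\<^sup>2 * (norm v)\<^sup>2"
proof -
  define w where "w = A *v v"
  define z where "z = v - (1 / s) *\<^sub>R w"
  have sym: "v \<bullet> (A *v w) = w \<bullet> w"
    using inner_matrix_vector_sym[OF loewner_le_mat_left(1)[OF lower], of v w] by (simp add: w_def)
  have "0 \<le> a * (z \<bullet> z)" using \<open>0 \<le> a\<close> by simp
  also have "\<dots> \<le> z \<bullet> (A *v z)" by (rule loewner_le_mat_left(2)[OF lower])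
  also have "\<dots> = v \<bullet> (A *v v) - 2 / s * (w \<bullet> w) + (1 / s)\<^sup>2 * (w \<bullet> (A *v w))"
    by (simp add: z_def matrix_vector_mult_diff_distrib matrix_vector_mult_scaleR inner_diff_left
        inner_diff_right sym power2_eq_square diff_divide_distrib flip: w_def)
  also have "\<dots> \<le> s * (v \<bullet> v) - 2 / s * (w \<bullet> w) + (1 / s)\<^sup>2 * (s * (w \<bullet> w))"
    using loewner_le_mat_right[OF upper, of v]
      mult_left_mono[OF loewner_le_mat_right[OF upper, of w], of "(1 / s)\<^sup>2"] by simp
  also have "\<dots> = s * (v \<bullet> v) - (w \<bullet> w) / s"
    using \<open>0 < s\<close> by (simp add: power2_eq_square field_simps)
  finally have "w \<bullet> w \<le> s * (s * (v \<bullet> v))"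
    using \<open>0 < s\<close> by (simp add: field_simps)
  then show ?thesis by (simp add: w_def power2_norm_eq_inner power2_eq_square[of s] mult.assoc)
qed

text \<open>Polarizing \<open>g \<bullet> (A *v v)\<close> in the inner product of \<open>A\<close>, rather than splitting off \<open>v - g\<close>,
  keeps a multiple of the squared gradient on the left-hand side; this is what pays for the
  output index ranging over \<open>{1..K}\<close> instead of \<open>{0..<K}\<close>.\<close>

lemma quasi_newton_step_descent:
  fixes f :: "real^'n \<Rightarrow> real"
  assumes smooth: "L_smooth L f" and "0 \<le> L" "0 \<le> \<eta>"
    and lower: "loewner_le (mat a) A" and upper: "loewner_le A (mat s)" and "0 \<le> a" "0 < s"
  shows "f (x - \<eta> *\<^sub>R (A *v v)) + \<eta> * a / 2 * (norm (grad f x))\<^sup>2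
      + (\<eta> * a / 2 - L * \<eta>\<^sup>2 * s\<^sup>2 / 2) * (norm v)\<^sup>2
    \<le> f x + \<eta> * s / 2 * (norm (v - grad f x))\<^sup>2"
proof -
  define g where "g = grad f x"
  have "(v - g) \<bullet> (A *v (v - g)) = v \<bullet> (A *v v) - 2 * (g \<bullet> (A *v v)) + g \<bullet> (A *v g)"
    using inner_matrix_vector_sym[OF loewner_le_mat_left(1)[OF lower], of v g]
    by (simp add: matrix_vector_mult_diff_distrib inner_diff_left inner_diff_right)
  moreover have "(v - g) \<bullet> (A *v (v - g)) \<le> s * (norm (v - g))\<^sup>2"
    using loewner_le_mat_right[OF upper] by (simp add: power2_norm_eq_inner)
  moreover have "a * (norm v)\<^sup>2 \<le> v \<bullet> (A *v v)" "a * (norm g)\<^sup>2 \<le> g \<bullet> (A *v g)"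
    using loewner_le_mat_left(2)[OF lower] by (simp_all add: power2_norm_eq_inner)
  ultimately have "a * (norm v)\<^sup>2 + a * (norm g)\<^sup>2 - s * (norm (v - g))\<^sup>2 \<le> 2 * (g \<bullet> (A *v v))"
    by linarith
  then have 1: "\<eta> / 2 * (a * (norm v)\<^sup>2 + a * (norm g)\<^sup>2 - s * (norm (v - g))\<^sup>2)
      \<le> \<eta> / 2 * (2 * (g \<bullet> (A *v v)))"
    using \<open>0 \<le> \<eta>\<close> by (intro mult_left_mono) auto
  have "f (x - \<eta> *\<^sub>R (A *v v)) \<le> f x - \<eta> * (g \<bullet> (A *v v)) + L / 2 * (\<eta>\<^sup>2 * (norm (A *v v))\<^sup>2)"
    using L_smooth_upper_bound[OF smooth, of "x - \<eta> *\<^sub>R (A *v v)" x]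
    by (simp add: g_def power_mult_distrib)
  also have "\<dots> \<le> f x - \<eta> * (g \<bullet> (A *v v)) + L / 2 * (\<eta>\<^sup>2 * (s\<^sup>2 * (norm v)\<^sup>2))"
    using loewner_bounds_norm[OF lower upper] \<open>0 \<le> L\<close> \<open>0 \<le> a\<close> \<open>0 < s\<close>
    by (intro add_left_mono mult_left_mono) auto
  finally show ?thesis using 1 by (simp add: g_def algebra_simps)
qed

lemma quasi_newton_step_grad:
  fixes f :: "real^'n \<Rightarrow> real"
  assumes smooth: "L_smooth L f" and "0 \<le> L"
    and lower: "loewner_le (mat a) A" and upper: "loewner_le A (mat s)" and "0 \<le> a" "0 < s"
  shows "(norm (grad f (x - \<eta> *\<^sub>R (A *v v))))\<^sup>2
    \<le> 2 * (norm (grad f x))\<^sup>2 + 2 * (L\<^sup>2 * \<eta>\<^sup>2 * s\<^sup>2) * (norm v)\<^sup>2"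
proof -
  define y where "y = x - \<eta> *\<^sub>R (A *v v)"
  have "(norm (grad f y - grad f x))\<^sup>2 \<le> (L * norm (y - x))\<^sup>2"
    using smooth by (intro power_mono) (auto simp: L_smooth_def)
  also have "\<dots> = L\<^sup>2 * \<eta>\<^sup>2 * (norm (A *v v))\<^sup>2"
    by (simp add: y_def power_mult_distrib)
  also have "\<dots> \<le> L\<^sup>2 * \<eta>\<^sup>2 * (s\<^sup>2 * (norm v)\<^sup>2)"
    using loewner_bounds_norm[OF lower upper] \<open>0 \<le> a\<close> \<open>0 < s\<close> by (intro mult_left_mono) auto
  finally have 1: "(norm (grad f y - grad f x))\<^sup>2 \<le> L\<^sup>2 * \<eta>\<^sup>2 * s\<^sup>2 * (norm v)\<^sup>2" by simp
  \<comment> \<open>Expanding this square gives \<open>|a|^2 <= 2 |b|^2 + 2 |a - b|^2\<close> for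
    \<open>a = grad f y\<close> and \<open>b = grad f x\<close>.\<close>
  have "0 \<le> (norm (2 *\<^sub>R grad f x - grad f y))\<^sup>2" by (rule zero_le_power2)
  then have "(norm (grad f y))\<^sup>2 \<le> 2 * (norm (grad f x))\<^sup>2 + 2 * (norm (grad f y - grad f x))\<^sup>2"
    by (simp add: power2_norm_eq_inner inner_diff_left inner_diff_right
        inner_commute[of "grad f x" "grad f y"])
  then show ?thesis using 1 by (simp add: y_def)
qed

section \<open>Measurability\<close>

text \<open>The second argument is replaced by simple approximations, each with finitely many
  values, and continuity passes to the limit. Joint measurability matters because sampled gradients
  are evaluated at random iterates.\<close>

lemma borel_measurable_caratheodory:
  fixes f :: "'u \<Rightarrow> 'a::{second_countable_topology, metric_space} \<Rightarrow> 'b::metric_space"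
  assumes meas: "\<And>y. (\<lambda>u. f u y) \<in> borel_measurable M"
    and cont: "\<And>u. u \<in> space M \<Longrightarrow> continuous_on UNIV (f u)"
  shows "(\<lambda>(u, y). f u y) \<in> borel_measurable (M \<Otimes>\<^sub>M borel)"
proof -
  obtain s :: "nat \<Rightarrow> 'a \<Rightarrow> 'a"
    where s: "\<And>i. simple_function borel (s i)" "\<And>y. (\<lambda>i. s i y) \<longlonglongrightarrow> y"
    using borel_measurable_implies_sequence_metric[of "\<lambda>y::'a. y" borel undefined] by auto
  have fin: "finite (range (s i))" for i
    using simple_functionD(1)[OF s(1)[of i]] by simp
  have "(\<lambda>p. f (fst p) (s i (snd p))) \<in> borel_measurable (M \<Otimes>\<^sub>M borel)" for i
  proof (rule measurable_compose_countable'[where I = "range (s i)"])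
    show "(\<lambda>p. f (fst p) z) \<in> borel_measurable (M \<Otimes>\<^sub>M borel)" for z
      using measurable_compose[OF measurable_fst meas] .
    have "s i \<in> measurable borel (count_space (range (s i)))"
      using s(1)[of i] fin by (auto simp: measurable_count_space_eq2 simple_function_def)
    then show "(\<lambda>p. s i (snd p)) \<in> measurable (M \<Otimes>\<^sub>M borel) (count_space (range (s i)))"
      by (rule measurable_compose[OF measurable_snd])
  qed (use fin in \<open>auto intro: countable_finite\<close>)
  then show ?thesis
    unfolding case_prod_beta
  proof (rule borel_measurable_LIMSEQ_metric)
    fix p :: "'u \<times> 'a" assume "p \<in> space (M \<Otimes>\<^sub>M borel)"
    then have "fst p \<in> space M" by (auto simp: space_pair_measure)
    then have "isCont (f (fst p)) (snd p)" using cont by (simp add: continuous_on_eq_continuous_at)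
    then show "(\<lambda>i. f (fst p) (s i (snd p))) \<longlonglongrightarrow> f (fst p) (snd p)"
      using s(2) by (rule isCont_tendsto_compose)
  qed
qed

lemma borel_measurable_matrix_matrix_mult [measurable (raw)]:
  fixes A :: "'a \<Rightarrow> real^'n^'m" and B :: "'a \<Rightarrow> real^'k^'n"
  assumes "A \<in> borel_measurable G" "B \<in> borel_measurable G"
  shows "(\<lambda>\<omega>. A \<omega> ** B \<omega>) \<in> borel_measurable G"
  using assms by (rule borel_measurable_continuous_Pair)
    (auto simp: matrix_matrix_mult_def intro!: continuous_intros)

lemma borel_measurable_matrix_vector_mult [measurable (raw)]:
  fixes A :: "'a \<Rightarrow> real^'n^'m" and z :: "'a \<Rightarrow> real^'n"
  assumes "A \<in> borel_measurable G" "z \<in> borel_measurable G"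
  shows "(\<lambda>\<omega>. A \<omega> *v z \<omega>) \<in> borel_measurable G"
  using assms by (rule borel_measurable_continuous_Pair)
    (auto simp: matrix_vector_mult_def intro!: continuous_intros)

lemma borel_measurable_outer [measurable (raw)]:
  assumes "y \<in> borel_measurable G" "z \<in> borel_measurable G"
  shows "(\<lambda>\<omega>. outer (y \<omega>) (z \<omega>)) \<in> borel_measurable G"
  using assms by (rule borel_measurable_continuous_Pair)
    (auto simp: outer_def intro!: continuous_intros)

lemma borel_measurable_mat [measurable (raw)]:
  assumes "c \<in> borel_measurable G"
  shows "(\<lambda>\<omega>. mat (c \<omega>) :: real^'n^'n) \<in> borel_measurable G"
proof -
  have "mat r = r *\<^sub>R (mat 1 :: real^'n^'n)" for r by (simp add: mat_def vec_eq_iff)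
  then have "(\<lambda>\<omega>. mat (c \<omega>) :: real^'n^'n) = (\<lambda>\<omega>. c \<omega> *\<^sub>R mat 1)" by (rule ext)
  then show ?thesis by (simp only: assms borel_measurable_scaleR borel_measurable_const)
qed

text \<open>Measurability is required only up to index \<open>k\<close>, so that the matrix of
  iteration \<open>k\<close> turns out to be a function of the samples drawn up to and including
  that iteration.\<close>

lemma borel_measurable_sdlbfgs:
  fixes X V :: "nat \<Rightarrow> 'a \<Rightarrow> real^'n"
  assumes X: "\<And>j. j \<le> k \<Longrightarrow> X j \<in> borel_measurable G"
    and V: "\<And>j. j \<le> k \<Longrightarrow> V j \<in> borel_measurable G"
  shows "(\<lambda>\<omega>. sdlbfgs m \<delta> \<gamma>0 (\<lambda>j. X j \<omega>) (\<lambda>j. V j \<omega>) k) \<in> borel_measurable G"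
proof -
  have [measurable]: "(\<lambda>\<omega>. sdl_s (\<lambda>j. X j \<omega>) j) \<in> borel_measurable G"
      "(\<lambda>\<omega>. sdl_ybar (\<lambda>j. V j \<omega>) j) \<in> borel_measurable G" if "j < k" for j
    using X[of j] X[of "Suc j"] V[of j] V[of "Suc j"] that by (auto simp: sdl_s_def sdl_ybar_def)
  have gamma [measurable]:
      "(\<lambda>\<omega>. sdl_gamma \<delta> \<gamma>0 (\<lambda>j. X j \<omega>) (\<lambda>j. V j \<omega>) j) \<in> borel_measurable G" if "j \<le> k" for j
  proof (cases j)
    case (Suc i)
    then have [measurable]: "i < k" using that by simp
    show ?thesis unfolding sdl_gamma_def Suc nat.case by measurable
  qed (simp add: sdl_gamma_def)
  have H0 [measurable]: "(\<lambda>\<omega>. sdl_H0_inv \<delta> \<gamma>0 (\<lambda>j. X j \<omega>) (\<lambda>j. V j \<omega>) j) \<in> borel_measurable G"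
      "(\<lambda>\<omega>. sdl_H0 \<delta> \<gamma>0 (\<lambda>j. X j \<omega>) (\<lambda>j. V j \<omega>) j) \<in> borel_measurable G" if "j \<le> k" for j
    using gamma[OF that] unfolding sdl_H0_inv_def sdl_H0_def by measurable
  have update: "(\<lambda>\<omega>. sdl_update \<delta> \<gamma>0 (\<lambda>j. X j \<omega>) (\<lambda>j. V j \<omega>) j (A \<omega>)) \<in> borel_measurable G"
    if [measurable]: "j < k" "A \<in> borel_measurable G" for j A
  proof -
    have [measurable]: "Suc j \<le> k" using \<open>j < k\<close> by simp
    show ?thesis
      unfolding sdl_update_def sdl_rho_def sdl_yhat_def sdl_theta_def sdl_sigma_def by measurable
  qed
  have "(\<lambda>\<omega>. fold (sdl_update \<delta> \<gamma>0 (\<lambda>j. X j \<omega>) (\<lambda>j. V j \<omega>)) js (A \<omega>)) \<in> borel_measurable G"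
    if "\<forall>j\<in>set js. j < k" "A \<in> borel_measurable G" for js A
    using that
  proof (induction js arbitrary: A)
    case (Cons j js)
    then show ?case
      using Cons.IH[of "\<lambda>\<omega>. sdl_update \<delta> \<gamma>0 (\<lambda>j. X j \<omega>) (\<lambda>j. V j \<omega>) j (A \<omega>)"] update by simp
  qed simp
  from this[of "[k - m..<k]"] show ?thesis unfolding sdlbfgs_def using H0(2)[OF order_refl] by simp
qed

section \<open>Independence and variance\<close>

text \<open>Conditioning on a sub-sigma-algebra \<open>G\<close> by freezing: \<open>G\<close> is independent of \<open>Y\<close>, so the pair
  of the identity (into \<open>G\<close>) and \<open>Y\<close> has a product distribution.\<close>

lemma (in prob_space) nn_integral_indep_subalgebra:
  assumes G: "subalgebra M G" and Y: "Y \<in> measurable M N"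
    and indep: "indep_set (sets G) (sets (vimage_algebra (space M) Y N))"
    and h [measurable]: "case_prod h \<in> borel_measurable (G \<Otimes>\<^sub>M N)"
  shows "(\<integral>\<^sup>+\<omega>. h \<omega> (Y \<omega>) \<partial>M) = (\<integral>\<^sup>+\<omega>. (\<integral>\<^sup>+y. h \<omega> y \<partial>distr M N Y) \<partial>M)"
proof -
  have id: "(\<lambda>\<omega>. \<omega>) \<in> measurable M G"
    using G by (auto simp: subalgebra_def measurable_def)
  interpret Y: prob_space "distr M N Y" by (rule prob_space_distr[OF Y])
  interpret G: prob_space "distr M G (\<lambda>\<omega>. \<omega>)" by (rule prob_space_distr[OF id])
  \<comment> \<open>Independence is the product formula on rectangles, and rectangles determine a
    product of sigma-finite measures.\<close>
  have prod: "distr M G (\<lambda>\<omega>. \<omega>) \<Otimes>\<^sub>M distr M N Y = distr M (G \<Otimes>\<^sub>M N) (\<lambda>\<omega>. (\<omega>, Y \<omega>))"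
  proof (rule pair_measure_eqI)
    fix A B assume "A \<in> sets (distr M G (\<lambda>\<omega>. \<omega>))" "B \<in> sets (distr M N Y)"
    then have A: "A \<in> sets G" and B: "B \<in> sets N" by simp_all
    have "A \<subseteq> space M" using sets.sets_into_space[OF A] G by (simp add: subalgebra_def)
    then have eq: "(\<lambda>\<omega>. (\<omega>, Y \<omega>)) -` (A \<times> B) \<inter> space M = A \<inter> (Y -` B \<inter> space M)" by auto
    have "prob (A \<inter> (Y -` B \<inter> space M)) = prob A * prob (Y -` B \<inter> space M)"
      by (rule indep_setD[OF indep A in_vimage_algebra[OF B]])
    moreover have "(\<lambda>\<omega>. \<omega>) -` A \<inter> space M = A" using \<open>A \<subseteq> space M\<close> by auto
    ultimately show "emeasure (distr M G (\<lambda>\<omega>. \<omega>)) A * emeasure (distr M N Y) B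
        = emeasure (distr M (G \<Otimes>\<^sub>M N) (\<lambda>\<omega>. (\<omega>, Y \<omega>))) (A \<times> B)"
      using A B id Y by (simp add: emeasure_distr eq emeasure_eq_measure ennreal_mult)
  next
    show "sets (distr M G (\<lambda>\<omega>. \<omega>) \<Otimes>\<^sub>M distr M N Y)
        = sets (distr M (G \<Otimes>\<^sub>M N) (\<lambda>\<omega>. (\<omega>, Y \<omega>)))"
      unfolding sets_distr by (rule sets_pair_measure_cong) simp_all
  qed (rule G.sigma_finite_measure_axioms Y.sigma_finite_measure_axioms)+
  have sets_prod: "sets (distr M G (\<lambda>\<omega>. \<omega>) \<Otimes>\<^sub>M distr M N Y) = sets (G \<Otimes>\<^sub>M N)"
    by (rule sets_pair_measure_cong) simp_all
  have h': "case_prod h \<in> borel_measurable (distr M G (\<lambda>\<omega>. \<omega>) \<Otimes>\<^sub>M distr M N Y)"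
    using h by (subst measurable_cong_sets[OF sets_prod refl])
  have "(\<integral>\<^sup>+\<omega>. h \<omega> (Y \<omega>) \<partial>M)
      = (\<integral>\<^sup>+p. case_prod h p \<partial>distr M (G \<Otimes>\<^sub>M N) (\<lambda>\<omega>. (\<omega>, Y \<omega>)))"
    using id Y by (subst nn_integral_distr) auto
  also have "\<dots> = (\<integral>\<^sup>+\<omega>. (\<integral>\<^sup>+y. h \<omega> y \<partial>distr M N Y) \<partial>distr M G (\<lambda>\<omega>. \<omega>))"
    using Y.nn_integral_fst[OF h', unfolded prod] by simp
  also have "\<dots> = (\<integral>\<^sup>+\<omega>. (\<integral>\<^sup>+y. h \<omega> y \<partial>distr M N Y) \<partial>M)"
    using Y.borel_measurable_nn_integral_fst[of "case_prod h" G] h id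
    by (intro nn_integral_distr) simp_all
  finally show ?thesis .
qed

text \<open>The cross term integrates to zero because \<open>z\<close> is centred. The vector
  \<open>c\<close> stands for a quantity of the past, frozen while the new sample varies.\<close>

lemma (in prob_space) nn_integral_square_norm_add:
  fixes z :: "'a \<Rightarrow> 'b::euclidean_space"
  assumes z: "integrable M z" "(\<integral>y. z y \<partial>M) = 0"
    and sq: "integrable M (\<lambda>y. (norm (z y))\<^sup>2)" "(\<integral>y. (norm (z y))\<^sup>2 \<partial>M) \<le> B"
  shows "(\<integral>\<^sup>+y. ennreal ((norm (c + z y))\<^sup>2) \<partial>M) \<le> ennreal ((norm c)\<^sup>2 + B)"
proof -
  have expand: "(norm (c + z y))\<^sup>2 = (norm c)\<^sup>2 + 2 * (c \<bullet> z y) + (norm (z y))\<^sup>2" for y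
    by (simp add: power2_norm_eq_inner inner_add_left inner_add_right inner_commute[of "z y" c])
  have "integrable M (\<lambda>y. (norm (c + z y))\<^sup>2)"
    unfolding expand using z sq by simp
  then have "(\<integral>\<^sup>+y. ennreal ((norm (c + z y))\<^sup>2) \<partial>M) = ennreal (\<integral>y. (norm (c + z y))\<^sup>2 \<partial>M)"
    by (intro nn_integral_eq_integral) auto
  also have "(\<integral>y. (norm (c + z y))\<^sup>2 \<partial>M) = (norm c)\<^sup>2 + (\<integral>y. (norm (z y))\<^sup>2 \<partial>M)"
    unfolding expand using z sq by (simp add: prob_space)
  finally show ?thesis using sq(2) by (simp only:) (rule ennreal_leI, simp)
qed

text \<open>The second moment about the mean is at most the one about the origin. The pointwise
  bound on \<open>Z\<close> also supplies square integrability.\<close>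

lemma (in prob_space) variance_le_bound:
  fixes Z :: "'a \<Rightarrow> 'b::euclidean_space"
  assumes Z: "integrable M Z" and bound: "\<And>y. y \<in> space M \<Longrightarrow> (norm (Z y))\<^sup>2 \<le> C"
  defines "c \<equiv> (\<integral>y. Z y \<partial>M)"
  shows "integrable M (\<lambda>y. (norm (Z y - c))\<^sup>2)" "(\<integral>y. (norm (Z y - c))\<^sup>2 \<partial>M) \<le> C"
proof -
  have expand: "(norm (Z y - c))\<^sup>2 = (norm (Z y))\<^sup>2 - 2 * (Z y \<bullet> c) + (norm c)\<^sup>2" for y
    by (simp add: power2_norm_eq_inner inner_diff_left inner_diff_right inner_commute[of c "Z y"])
  have sq: "integrable M (\<lambda>y. (norm (Z y))\<^sup>2)"
    using bound Z by (intro integrable_const_bound[of _ C]) auto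
  then show "integrable M (\<lambda>y. (norm (Z y - c))\<^sup>2)" unfolding expand using Z by simp
  have "(\<integral>y. (norm (Z y - c))\<^sup>2 \<partial>M) = (\<integral>y. (norm (Z y))\<^sup>2 \<partial>M) - 2 * (c \<bullet> c) + (norm c)\<^sup>2"
    unfolding expand using Z sq by (simp add: prob_space c_def)
  also have "\<dots> \<le> (\<integral>y. (norm (Z y))\<^sup>2 \<partial>M)" by (simp add: power2_norm_eq_inner)
  also have "\<dots> \<le> (\<integral>y. C \<partial>M)" using sq bound by (intro integral_mono) auto
  finally show "(\<integral>y. (norm (Z y - c))\<^sup>2 \<partial>M) \<le> C" by (simp add: prob_space)
qed

text \<open>Centring each summand separately gives the form in which
  \<open>nn_integral_batch_noise\<close> adds the samples of a batch one by one.\<close>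

lemma mean_diff_eq_sum:
  fixes h :: "nat \<Rightarrow> 'a::real_vector"
  assumes "0 < n"
  shows "(1 / real n) *\<^sub>R (\<Sum>i<n. h i) - c = (\<Sum>i<n. (1 / real n) *\<^sub>R (h i - c))"
  using assms
  by (simp only: scaleR_sum_right[symmetric] sum_subtractf sum_constant_scaleR scaleR_diff_right) simp

lemma nn_integral_add_scaled:
  assumes [measurable]: "f \<in> borel_measurable M" "h \<in> borel_measurable M"
    and "\<And>y. 0 \<le> f y" "\<And>y. 0 \<le> h y" "0 \<le> a"
  shows "(\<integral>\<^sup>+y. ennreal (f y + a * h y) \<partial>M) = (\<integral>\<^sup>+y. ennreal (f y) \<partial>M) + ennreal a * (\<integral>\<^sup>+y. ennreal (h y) \<partial>M)"
  using assms(3-5) by (simp add: nn_integral_add nn_integral_cmult ennreal_plus ennreal_mult)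

section \<open>Smoothness of the objective and noise of the sampled gradients\<close>

context online_problem
begin

lemma norm_grad_diff_le:
  assumes "u \<in> space P"
  shows "norm (grad (F u) x - grad (F u) y) \<le> L * norm (x - y)"
  using smooth[OF assms] by (simp add: L_smooth_def)

text \<open>Smoothness passes from the samples to their mean: by \<open>unbiased\<close> the
  gradient of the objective is the mean of the sampled gradients, and the norm of an integral is at
  most the integral of the norm.\<close>

lemma L_smooth_objective: "L_smooth L (objective P F)"
  unfolding L_smooth_def
proof (intro conjI allI)
  fix x y
  show "objective P F differentiable (at x)" by (rule objective_diff)
  have "norm (grad (objective P F) x - grad (objective P F) y)
      = norm (\<integral>u. grad (F u) x - grad (F u) y \<partial>P)"
    by (simp add: unbiased integrable_grad)
  also have "\<dots> \<le> (\<integral>u. norm (grad (F u) x - grad (F u) y) \<partial>P)"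
    by (rule integral_norm_bound)
  also have "\<dots> \<le> (\<integral>u. L * norm (x - y) \<partial>P)"
    using norm_grad_diff_le by (intro integral_mono) (auto simp: integrable_grad)
  finally show "norm (grad (objective P F) x - grad (objective P F) y) \<le> L * norm (x - y)"
    by (simp add: prob_space)
qed

lemma borel_measurable_grad_objective [measurable]:
  "grad (objective P F) \<in> borel_measurable borel"
proof -
  have "L-lipschitz_on UNIV (grad (objective P F))"
    using L_smooth_objective L_pos by (auto simp: lipschitz_on_def L_smooth_def dist_norm)
  then show ?thesis
    using lipschitz_on_continuous_on by (blast intro: borel_measurable_continuous_onI)
qed

lemma borel_measurable_objective [measurable]: "objective P F \<in> borel_measurable borel"
  using objective_diff
  by (intro borel_measurable_continuous_onI differentiable_imp_continuous_on)
    (auto simp: differentiable_on_def intro: differentiable_at_withinI)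

lemma borel_measurable_grad_F [measurable]:
  "(\<lambda>(u, y). grad (F u) y) \<in> borel_measurable (P \<Otimes>\<^sub>M borel)"
proof (rule borel_measurable_caratheodory)
  show "(\<lambda>u. grad (F u) y) \<in> borel_measurable P" for y
    using integrable_grad by auto
  fix u assume "u \<in> space P"
  then have "L-lipschitz_on UNIV (grad (F u))"
    using norm_grad_diff_le L_pos by (auto simp: lipschitz_on_def dist_norm)
  then show "continuous_on UNIV (grad (F u))" by (rule lipschitz_on_continuous_on)
qed

text \<open>Both evaluations share one sample, so the noise is controlled by
  \<open>norm (x - y)\<close> instead of \<open>\<sigma>1\<close>: a variance is at most the second
  moment, which smoothness bounds pointwise. This is why the recursive estimator is accurate for
  short steps.\<close>

lemma grad_difference_noise:
  fixes x y
  defines "z \<equiv> \<lambda>u. grad (F u) x - grad (F u) y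
    - (grad (objective P F) x - grad (objective P F) y)"
  shows "integrable P z" "(\<integral>u. z u \<partial>P) = 0" "integrable P (\<lambda>u. (norm (z u))\<^sup>2)"
    "(\<integral>u. (norm (z u))\<^sup>2 \<partial>P) \<le> L\<^sup>2 * (norm (x - y))\<^sup>2"
proof -
  have mean: "grad (objective P F) x - grad (objective P F) y = (\<integral>u. grad (F u) x - grad (F u) y \<partial>P)"
    by (simp add: unbiased integrable_grad)
  have bound: "(norm (grad (F u) x - grad (F u) y))\<^sup>2 \<le> L\<^sup>2 * (norm (x - y))\<^sup>2" if "u \<in> space P" for u
    using power_mono[OF norm_grad_diff_le[OF that]] by (simp add: power_mult_distrib)
  show "integrable P z" "(\<integral>u. z u \<partial>P) = 0"
    unfolding z_def by (simp_all add: integrable_grad unbiased prob_space)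
  show "integrable P (\<lambda>u. (norm (z u))\<^sup>2)" "(\<integral>u. (norm (z u))\<^sup>2 \<partial>P) \<le> L\<^sup>2 * (norm (x - y))\<^sup>2"
    unfolding z_def mean
    by (rule variance_le_bound, simp add: integrable_grad, erule bound)+
qed

lemma grad_noise:
  fixes x
  defines "z \<equiv> \<lambda>u. grad (F u) x - grad (objective P F) x"
  shows "integrable P z" "(\<integral>u. z u \<partial>P) = 0" "integrable P (\<lambda>u. (norm (z u))\<^sup>2)"
    "(\<integral>u. (norm (z u))\<^sup>2 \<partial>P) \<le> \<sigma>1\<^sup>2"
  unfolding z_def using integrable_variance variance_bound
  by (simp_all add: integrable_grad unbiased prob_space)

lemma borel_measurable_batch_grad:
  assumes X: "X \<in> borel_measurable G" and \<xi>: "\<And>i. i < n \<Longrightarrow> \<xi> i \<in> measurable G P"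
  shows "(\<lambda>\<omega>. batch_grad F n (\<lambda>i. \<xi> i \<omega>) (X \<omega>)) \<in> borel_measurable G"
proof -
  have "(\<lambda>\<omega>. grad (F (\<xi> i \<omega>)) (X \<omega>)) \<in> borel_measurable G" if "i < n" for i
    using measurable_compose[OF measurable_Pair[OF \<xi>[OF that] X] borel_measurable_grad_F] by simp
  then show ?thesis unfolding batch_grad_def by measurable
qed

end

section \<open>The accumulated estimator error\<close>

text \<open>Each \<open>V j\<close> enters \<open>e k\<close> only for later \<open>k\<close> in the same epoch, that is at most \<open>q\<close> times,
  which cancels the factor \<open>1 / q\<close>.\<close>

lemma epoch_error_sum:
  fixes e V :: "nat \<Rightarrow> real"
  assumes "0 < q" and V: "\<And>k. 0 \<le> V k" and "0 \<le> \<alpha>"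
    and restart: "\<And>k. k < K \<Longrightarrow> q dvd k \<Longrightarrow> e k \<le> \<tau>"
    and step: "\<And>k. k < K \<Longrightarrow> \<not> q dvd k \<Longrightarrow> e k \<le> e (k - 1) + \<alpha> / real q * V (k - 1)"
  shows "(\<Sum>k<K. e k) \<le> real K * \<tau> + \<alpha> * (\<Sum>k<K. V k)"
proof -
  \<comment> \<open>Equal quotients by \<open>q\<close> mean the same epoch, so summing over
    \<open>j\<close> collects what has entered the error at \<open>k\<close> since the last
    restart.\<close>
  let ?I = "\<lambda>k j. if j < k \<and> j div q = k div q then V j else 0"
  have bound: "e k \<le> \<tau> + \<alpha> / real q * (\<Sum>j<k. ?I k j)" if "k < K" for k
    using that
  proof (induction k)
    case 0
    then show ?case using restart[of 0] by simp
  next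
    case (Suc k)
    show ?case
    proof (cases "q dvd Suc k")
      case True
      have "0 \<le> \<alpha> / real q * (\<Sum>j<Suc k. ?I (Suc k) j)"
        using V \<open>0 \<le> \<alpha>\<close> by (intro mult_nonneg_nonneg sum_nonneg) auto
      then show ?thesis using restart[OF Suc.prems True] by simp
    next
      case False
      \<comment> \<open>An index that is not a restart lies in the epoch of its predecessor, so the
        sum gains exactly the term \<open>V k\<close>.\<close>
      then have "k div q = Suc k div q" by (simp add: div_Suc dvd_eq_mod_eq_0)
      then have "(\<Sum>j<Suc k. ?I (Suc k) j) = (\<Sum>j<k. ?I k j) + V k"
        by (auto intro!: sum.cong)
      then show ?thesis
        using step[OF Suc.prems False] Suc by (simp add: distrib_left)
    qed
  qed
  have count: "(\<Sum>k<K. if j < k \<and> j div q = k div q then V j else 0) \<le> real q * V j" for j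
  proof -
    \<comment> \<open>The epoch of \<open>j\<close> starts no later than \<open>j\<close> and has
      length \<open>q\<close>, so its later indices lie within \<open>q\<close> of
      \<open>j\<close>.\<close>
    have sub: "{k. k < K \<and> j < k \<and> j div q = k div q} \<subseteq> {j<..j + q}"
    proof
      fix k assume k: "k \<in> {k. k < K \<and> j < k \<and> j div q = k div q}"
      then have "k = j div q * q + k mod q" using div_mult_mod_eq[of k q] by simp
      also have "\<dots> \<le> j + q" using \<open>0 < q\<close> by (intro add_mono) (auto intro: less_imp_le)
      finally show "k \<in> {j<..j + q}" using k by simp
    qed
    have "(\<Sum>k<K. if j < k \<and> j div q = k div q then V j else 0)
        = real (card {k. k < K \<and> j < k \<and> j div q = k div q}) * V j"
      by (simp add: sum.If_cases Int_def lessThan_def)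
    also have "\<dots> \<le> real q * V j"
      using card_mono[OF _ sub] V by (intro mult_right_mono) auto
    finally show ?thesis .
  qed
  have "(\<Sum>k<K. e k) \<le> (\<Sum>k<K. \<tau> + \<alpha> / real q * (\<Sum>j<K. ?I k j))"
  proof (rule sum_mono)
    fix k assume "k \<in> {..<K}"
    then have "(\<Sum>j<k. ?I k j) \<le> (\<Sum>j<K. ?I k j)"
      using V by (intro sum_mono2) auto
    then have "\<alpha> / real q * (\<Sum>j<k. ?I k j) \<le> \<alpha> / real q * (\<Sum>j<K. ?I k j)"
      using \<open>0 \<le> \<alpha>\<close> by (intro mult_left_mono) auto
    then show "e k \<le> \<tau> + \<alpha> / real q * (\<Sum>j<K. ?I k j)"
      using bound \<open>k \<in> {..<K}\<close> by force
  qed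
  also have "\<dots> = real K * \<tau> + \<alpha> / real q * (\<Sum>j<K. \<Sum>k<K. ?I k j)"
    by (subst sum.swap) (simp add: sum.distrib sum_distrib_left)
  also have "\<dots> \<le> real K * \<tau> + \<alpha> / real q * (\<Sum>j<K. real q * V j)"
    using count \<open>0 \<le> \<alpha>\<close> by (intro add_left_mono mult_left_mono sum_mono) auto
  also have "\<dots> = real K * \<tau> + \<alpha> * (\<Sum>k<K. V k)"
    using \<open>0 < q\<close> by (simp flip: sum_distrib_left)
  finally show ?thesis .
qed

lemma spider_recursion:
  fixes \<Gamma> G V e :: "nat \<Rightarrow> real"
  assumes "0 < q" and nonneg: "\<And>k. 0 \<le> \<Gamma> k" "\<And>k. 0 \<le> V k" and "0 \<le> \<alpha>" "0 \<le> D"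
    and descent: "\<And>k. k < K \<Longrightarrow> \<Gamma> (Suc k) + A * G k + (\<beta> + D * \<alpha>) * V k \<le> \<Gamma> k + D * e k"
    and restart: "\<And>k. k < K \<Longrightarrow> q dvd k \<Longrightarrow> e k \<le> \<tau>"
    and step: "\<And>k. k < K \<Longrightarrow> \<not> q dvd k \<Longrightarrow> e k \<le> e (k - 1) + \<alpha> / real q * V (k - 1)"
  shows "A * (\<Sum>k<K. G k) + \<beta> * (\<Sum>k<K. V k) \<le> \<Gamma> 0 + D * (real K * \<tau>)"
proof -
  have "(\<Sum>k<K. \<Gamma> (Suc k) - \<Gamma> k) + A * (\<Sum>k<K. G k) + (\<beta> + D * \<alpha>) * (\<Sum>k<K. V k)
      = (\<Sum>k<K. \<Gamma> (Suc k) - \<Gamma> k + A * G k + (\<beta> + D * \<alpha>) * V k)"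
    by (simp add: sum.distrib sum_distrib_left)
  also have "\<dots> \<le> (\<Sum>k<K. D * e k)"
    using descent by (intro sum_mono) (smt (verit) lessThan_iff)
  also have "\<dots> = D * (\<Sum>k<K. e k)" by (simp add: sum_distrib_left)
  also have "\<dots> \<le> D * (real K * \<tau> + \<alpha> * (\<Sum>k<K. V k))"
    using assms by (intro mult_left_mono epoch_error_sum[where q = q]) auto
  finally show ?thesis
    using nonneg(1)[of K] by (simp add: sum_lessThan_telescope algebra_simps)
qed

section \<open>Analysis of a run\<close>

text \<open>Step size, epoch length and batch sizes are general positive numbers here; the
  prescribed values are inserted only in \<open>theorem4\<close>.\<close>

locale spider_sqn_analysis =
  problem: online_problem P F L \<kappa> \<sigma>1 +
  run: spider_sqn_run M P F x0 \<eta> q b0 b m \<delta> \<gamma>0 K U \<zeta> x v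
  for P :: "'u measure" and F :: "'u \<Rightarrow> real^'n \<Rightarrow> real" and L \<kappa> \<sigma>1
    and M :: "'w measure" and x0 \<eta> q b0 b m \<delta> \<gamma>0 K U \<zeta> x v +
  fixes smin smax :: real
  assumes bounded: "hess_approx_bounded M smin smax m \<delta> \<gamma>0 K x v"
    and smin_pos: "0 < smin" and smax_pos: "0 < smax" and \<eta>_pos: "0 < \<eta>"
    and q_pos: "0 < q" and b0_pos: "0 < b0" and b_pos: "0 < b" and K_pos: "0 < K"
begin

abbreviation "S \<equiv> sample_index q b0 b K"
abbreviation "g \<equiv> grad (objective P F)"

section \<open>The information generated by the samples\<close>

definition past :: "(nat \<times> nat) set \<Rightarrow> 'w measure" where
  "past J = vimage_algebra (space M) (\<lambda>\<omega>. \<lambda>p\<in>J. U (fst p) (snd p) \<omega>) (PiM J (\<lambda>_. P))"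

text \<open>The samples preceding the \<open>i\<close>-th one of iteration \<open>k\<close> in the
  order of drawing. Stopping inside a batch is allowed, so that samples can be revealed singly;
  \<open>before k 0\<close> holds the batches of all earlier iterations.\<close>

definition before :: "nat \<Rightarrow> nat \<Rightarrow> (nat \<times> nat) set" where
  "before k i = {p \<in> S. fst p < k \<or> fst p = k \<and> snd p < i}"

lemma space_past [simp]: "space (past J) = space M"
  by (simp add: past_def)

lemma before_subset: "before k i \<subseteq> S"
  by (auto simp: before_def)

lemma before_mono: "j < k \<or> j = k \<and> l \<le> i \<Longrightarrow> before j l \<subseteq> before k i"
  by (auto simp: before_def)

lemma measurable_sample: "p \<in> S \<Longrightarrow> U (fst p) (snd p) \<in> measurable M P"
  using run.samples_indep by (auto simp: run.indep_vars_def2)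

lemma measurable_samples:
  "J \<subseteq> S \<Longrightarrow> (\<lambda>\<omega>. \<lambda>p\<in>J. U (fst p) (snd p) \<omega>) \<in> measurable M (PiM J (\<lambda>_. P))"
  using measurable_sample by (intro measurable_restrict) auto

lemma subalgebra_past: "J \<subseteq> S \<Longrightarrow> subalgebra M (past J)"
  unfolding subalgebra_def past_def by (simp add: sets_image_in_sets[OF refl measurable_samples])

lemma measurable_sample_past:
  assumes "J \<subseteq> S" "p \<in> J"
  shows "U (fst p) (snd p) \<in> measurable (past J) P"
proof -
  have "(\<lambda>\<omega>. \<lambda>p\<in>J. U (fst p) (snd p) \<omega>) \<in> measurable (past J) (PiM J (\<lambda>_. P))"
    unfolding past_def using measurable_samples[OF \<open>J \<subseteq> S\<close>]
    by (intro measurable_vimage_algebra1) (auto simp: measurable_def)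
  from measurable_compose[OF this measurable_component_singleton[OF \<open>p \<in> J\<close>]]
  show ?thesis using \<open>p \<in> J\<close> by simp
qed

lemma measurable_past_mono:
  assumes "J \<subseteq> J'" "J' \<subseteq> S" and h: "h \<in> measurable (past J) N"
  shows "h \<in> measurable (past J') N"
proof -
  have "(\<lambda>\<omega>. \<lambda>p\<in>J. U (fst p) (snd p) \<omega>) \<in> measurable (past J') (PiM J (\<lambda>_. P))"
    using assms measurable_sample_past by (intro measurable_restrict) auto
  then have "sets (past J) \<subseteq> sets (past J')"
    unfolding past_def[of J] by (intro sets_image_in_sets) auto
  then show ?thesis using h by (auto simp: measurable_def)
qed

lemma measurable_past_run: "J \<subseteq> S \<Longrightarrow> h \<in> measurable (past J) N \<Longrightarrow> h \<in> measurable M N"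
  using subalgebra_past[of J] by (auto simp: measurable_def subalgebra_def)

text \<open>Joint independence of the family restricts to the disjoint index sets \<open>J\<close>
  and \<open>{p}\<close>. This is the hypothesis under which a new sample may be averaged with the
  past frozen.\<close>

lemma indep_past_sample:
  assumes "J \<subseteq> S" "p \<in> S" "p \<notin> J"
  shows "run.indep_set (sets (past J)) (sets (vimage_algebra (space M) (U (fst p) (snd p)) P))"
proof -
  have "run.indep_var (PiM J (\<lambda>_. P)) (\<lambda>\<omega>. \<lambda>p\<in>J. U (fst p) (snd p) \<omega>)
      (PiM {p} (\<lambda>_. P)) (\<lambda>\<omega>. \<lambda>p\<in>{p}. U (fst p) (snd p) \<omega>)"
    using assms by (intro run.indep_var_restrict[OF run.samples_indep]) auto
  then have indep: "run.indep_set (sets (past J)) (sets (past {p}))"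
    by (simp add: run.indep_var_eq past_def sets_vimage_algebra)
  have "sets (vimage_algebra (space M) (U (fst p) (snd p)) P) \<subseteq> sets (past {p})"
    using measurable_sample_past[of "{p}" p] \<open>p \<in> S\<close> by (intro sets_image_in_sets) auto
  then show ?thesis using indep unfolding run.indep_sets2_eq by blast
qed

text \<open>Iterates and estimators feed each other, hence a simultaneous induction. The ranges
  differ because \<open>x k\<close> is fixed before the batch of iteration \<open>k\<close> is
  drawn, whereas \<open>v k\<close> uses that batch.\<close>

lemma measurable_x_v:
  assumes "k \<le> K"
  shows "(\<forall>j\<le>k. x j \<in> borel_measurable (past (before k 0))) \<and>
    (\<forall>j<k. v j \<in> borel_measurable (past (before k 0)))"
  using assms
proof (induction k)
  case 0
  have "x 0 \<in> borel_measurable (past (before 0 0)) \<longleftrightarrow>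
      (\<lambda>\<omega>. x0) \<in> borel_measurable (past (before 0 0))"
    by (rule measurable_cong) (simp add: run.x_init)
  then show ?case by simp
next
  case (Suc k)
  let ?G = "past (before (Suc k) 0)"
  have "k < K" using Suc.prems by simp
  have mono: "h \<in> borel_measurable (past (before k 0)) \<Longrightarrow> h \<in> borel_measurable ?G"
    for h :: "'w \<Rightarrow> real^'n"
    by (rule measurable_past_mono[OF before_mono before_subset]) auto
  have x: "x j \<in> borel_measurable ?G" if "j \<le> k" for j
    using Suc.IH \<open>k < K\<close> that by (intro mono) auto
  have v_before: "v j \<in> borel_measurable ?G" if "j < k" for j
    using Suc.IH \<open>k < K\<close> that by (intro mono) auto
  have U: "U k i \<in> measurable ?G P" if "i < batch_size q b0 b k" for i
    using measurable_sample_past[OF before_subset, of "(k, i)" "Suc k" 0] that \<open>k < K\<close>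
    by (auto simp: before_def sample_index_def)
  have "v k \<in> borel_measurable ?G"
  proof (cases "q dvd k")
    case True
    have "v k \<in> borel_measurable ?G \<longleftrightarrow>
        (\<lambda>\<omega>. batch_grad F b0 (\<lambda>i. U k i \<omega>) (x k \<omega>)) \<in> borel_measurable ?G"
      using True \<open>k < K\<close> by (intro measurable_cong) (simp add: run.v_restart)
    then show ?thesis
      using problem.borel_measurable_batch_grad[of "x k" ?G b0 "U k"] x U True
      by (simp add: batch_size_def)
  next
    case False
    \<comment> \<open>Since \<open>q\<close> divides \<open>0\<close>, an index that is not a
      restart has a genuine predecessor.\<close>
    then have "k - 1 < k" by (cases k) auto
    have "v k \<in> borel_measurable ?G \<longleftrightarrow>
        (\<lambda>\<omega>. batch_grad F b (\<lambda>i. U k i \<omega>) (x k \<omega>)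
          - batch_grad F b (\<lambda>i. U k i \<omega>) (x (k - 1) \<omega>) + v (k - 1) \<omega>) \<in> borel_measurable ?G"
      using False \<open>k < K\<close> by (intro measurable_cong) (simp add: run.v_recursive)
    also have "\<dots>"
      using False U x v_before[OF \<open>k - 1 < k\<close>]
      by (intro borel_measurable_add borel_measurable_diff problem.borel_measurable_batch_grad)
        (auto simp: batch_size_def)
    finally show ?thesis .
  qed
  then have v: "v j \<in> borel_measurable ?G" if "j < Suc k" for j
    using v_before[of j] that by (cases "j = k") auto
  have "(\<lambda>\<omega>. hess_approx m \<delta> \<gamma>0 x v k \<omega>) \<in> borel_measurable ?G"
    unfolding hess_approx_def using x v by (intro borel_measurable_sdlbfgs) auto
  then have "(\<lambda>\<omega>. x k \<omega> - \<eta> *\<^sub>R (hess_approx m \<delta> \<gamma>0 x v k \<omega> *v v k \<omega>)) \<in> borel_measurable ?G"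
    using x[of k] v[of k] by measurable
  moreover have "x (Suc k) \<in> borel_measurable ?G \<longleftrightarrow>
      (\<lambda>\<omega>. x k \<omega> - \<eta> *\<^sub>R (hess_approx m \<delta> \<gamma>0 x v k \<omega> *v v k \<omega>)) \<in> borel_measurable ?G"
    using \<open>k < K\<close> by (intro measurable_cong) (simp add: run.x_step)
  ultimately have "x (Suc k) \<in> borel_measurable ?G" by simp
  then show ?case using x v by (auto simp: le_Suc_eq)
qed

lemma measurable_x_past: "k \<le> K \<Longrightarrow> x k \<in> borel_measurable (past (before k 0))"
  using measurable_x_v[of k] by blast

lemma measurable_x [measurable]: "k \<le> K \<Longrightarrow> x k \<in> borel_measurable M"
  by (rule measurable_past_run[OF before_subset measurable_x_past])

lemma measurable_v [measurable]: "k < K \<Longrightarrow> v k \<in> borel_measurable M"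
  using measurable_x_v[of "Suc k"] by (intro measurable_past_run[OF before_subset]) auto

text \<open>Adding the samples of one batch one at a time makes the partial sums a martingale, so that
  the cross terms vanish already in the freezing step.\<close>

lemma nn_integral_batch_noise:
  assumes "k < K" and "n \<le> batch_size q b0 b k"
    and A: "A \<in> borel_measurable (past (before k 0))"
    and z: "case_prod z \<in> borel_measurable (past (before k 0) \<Otimes>\<^sub>M P)"
    and B: "B \<in> borel_measurable M" "\<And>\<omega>. 0 \<le> B \<omega>"
    and mean: "\<And>\<omega>. \<omega> \<in> space M \<Longrightarrow> integrable P (z \<omega>)" "\<And>\<omega>. \<omega> \<in> space M \<Longrightarrow> (\<integral>u. z \<omega> u \<partial>P) = 0"
    and var: "\<And>\<omega>. \<omega> \<in> space M \<Longrightarrow> integrable P (\<lambda>u. (norm (z \<omega> u))\<^sup>2)"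
      "\<And>\<omega>. \<omega> \<in> space M \<Longrightarrow> (\<integral>u. (norm (z \<omega> u))\<^sup>2 \<partial>P) \<le> B \<omega>"
  shows "(\<integral>\<^sup>+\<omega>. ennreal ((norm (A \<omega> + (\<Sum>i<n. z \<omega> (U k i \<omega>)) :: real^'n))\<^sup>2) \<partial>M)
    \<le> (\<integral>\<^sup>+\<omega>. ennreal ((norm (A \<omega>))\<^sup>2) \<partial>M) + of_nat n * (\<integral>\<^sup>+\<omega>. ennreal (B \<omega>) \<partial>M)"
  using \<open>n \<le> batch_size q b0 b k\<close>
proof (induction n)
  case 0
  then show ?case by simp
next
  case (Suc n)
  let ?J = "before k n"
  let ?G = "past ?J"
  define T where "T \<omega> = A \<omega> + (\<Sum>i<n. z \<omega> (U k i \<omega>))" for \<omega>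
  \<comment> \<open>The next sample lies outside the information \<open>?J\<close> that determines
    the partial sum \<open>T\<close>.\<close>
  have mem: "(k, n) \<in> S" "(k, n) \<notin> ?J"
    using Suc.prems \<open>k < K\<close> by (auto simp: sample_index_def before_def)
  have "before k 0 \<subseteq> ?J" by (rule before_mono) simp
  then have id: "(\<lambda>\<omega>. \<omega>) \<in> measurable ?G (past (before k 0))"
    using before_subset by (intro measurable_past_mono[of "before k 0" ?J]) auto
  have z_u: "(\<lambda>\<omega>. z (h \<omega>) (Y \<omega>)) \<in> borel_measurable N"
    if "h \<in> measurable N ?G" "Y \<in> measurable N P" for h Y and N :: "'x measure"
    using measurable_compose[OF measurable_Pair[OF measurable_compose[OF that(1) id] that(2)] z]
    by simp
  have U: "U k i \<in> measurable ?G P" if "i < n" for i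
    using measurable_sample_past[OF before_subset, of "(k, i)" k n] that Suc.prems \<open>k < K\<close>
    by (auto simp: before_def sample_index_def)
  have T: "T \<in> borel_measurable ?G"
    unfolding T_def using measurable_compose[OF id A] z_u[OF measurable_ident U]
    by (intro borel_measurable_add borel_measurable_sum) (auto simp: id_def)
  have T_run: "T \<in> borel_measurable M" by (rule measurable_past_run[OF before_subset T])
  have "(\<integral>\<^sup>+\<omega>. ennreal ((norm (T \<omega> + z \<omega> (U k n \<omega>)))\<^sup>2) \<partial>M)
      = (\<integral>\<^sup>+\<omega>. (\<integral>\<^sup>+u. ennreal ((norm (T \<omega> + z \<omega> u))\<^sup>2) \<partial>distr M P (U k n)) \<partial>M)"
  proof (rule run.nn_integral_indep_subalgebra[OF subalgebra_past[OF before_subset]])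
    show "U k n \<in> measurable M P" using measurable_sample[OF mem(1)] by simp
    show "run.indep_set (sets ?G) (sets (vimage_algebra (space M) (U k n) P))"
      using indep_past_sample[OF before_subset mem] by simp
    have "(\<lambda>p. T (fst p)) \<in> borel_measurable (?G \<Otimes>\<^sub>M P)"
      by (rule measurable_compose[OF measurable_fst T])
    moreover have "(\<lambda>p. z (fst p) (snd p)) \<in> borel_measurable (?G \<Otimes>\<^sub>M P)"
      by (rule z_u[OF measurable_fst measurable_snd])
    ultimately show "(\<lambda>(\<omega>, u). ennreal ((norm (T \<omega> + z \<omega> u))\<^sup>2)) \<in> borel_measurable (?G \<Otimes>\<^sub>M P)"
      unfolding case_prod_beta by measurable
  qed
  \<comment> \<open>With \<open>\<omega>\<close> frozen, the new term is centred under
    \<open>P\<close> and adds at most \<open>B \<omega>\<close> to the squared norm.\<close>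
  also have "\<dots> \<le> (\<integral>\<^sup>+\<omega>. ennreal ((norm (T \<omega>))\<^sup>2 + B \<omega>) \<partial>M)"
    unfolding run.samples_distr[OF mem(1)]
    by (intro nn_integral_mono problem.nn_integral_square_norm_add mean var)
  also have "\<dots> = (\<integral>\<^sup>+\<omega>. ennreal ((norm (T \<omega>))\<^sup>2) \<partial>M) + (\<integral>\<^sup>+\<omega>. ennreal (B \<omega>) \<partial>M)"
    using T_run B by (simp add: nn_integral_add)
  also have "\<dots> \<le> (\<integral>\<^sup>+\<omega>. ennreal ((norm (A \<omega>))\<^sup>2) \<partial>M) + of_nat n * (\<integral>\<^sup>+\<omega>. ennreal (B \<omega>) \<partial>M)
      + (\<integral>\<^sup>+\<omega>. ennreal (B \<omega>) \<partial>M)"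
    using Suc.IH Suc.prems by (intro add_right_mono) (simp add: T_def)
  finally show ?case by (simp add: T_def algebra_simps)
qed

section \<open>Mean square error of the gradient estimator\<close>

lemma past_pair_measurable_grad:
  assumes "X \<in> borel_measurable G"
  shows "(\<lambda>(\<omega>, u). grad (F u) (X \<omega>)) \<in> borel_measurable (G \<Otimes>\<^sub>M P)"
  using measurable_compose[OF measurable_Pair[OF measurable_snd
      measurable_compose[OF measurable_fst assms]] problem.borel_measurable_grad_F]
  by (simp add: case_prod_beta)

lemma past_pair_measurable_objective_grad:
  assumes "X \<in> borel_measurable G"
  shows "(\<lambda>(\<omega>, u). g (X \<omega>)) \<in> borel_measurable (G \<Otimes>\<^sub>M P)"
  unfolding case_prod_beta
  by (rule measurable_compose[OF measurable_compose[OF measurable_fst assms]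
      problem.borel_measurable_grad_objective])

text \<open>Subtracting the infimum makes the integrand nonnegative, so that \<open>ennreal\<close>
  truncates nothing.\<close>

definition gap_mean :: "nat \<Rightarrow> ennreal" where
  "gap_mean k = (\<integral>\<^sup>+\<omega>. ennreal (objective P F (x k \<omega>) - (INF y. objective P F y)) \<partial>M)"

definition grad_sq :: "nat \<Rightarrow> ennreal" where
  "grad_sq k = (\<integral>\<^sup>+\<omega>. ennreal ((norm (g (x k \<omega>)))\<^sup>2) \<partial>M)"

definition est_sq :: "nat \<Rightarrow> ennreal" where
  "est_sq k = (\<integral>\<^sup>+\<omega>. ennreal ((norm (v k \<omega>))\<^sup>2) \<partial>M)"

definition err_sq :: "nat \<Rightarrow> ennreal" where
  "err_sq k = (\<integral>\<^sup>+\<omega>. ennreal ((norm (v k \<omega> - g (x k \<omega>)))\<^sup>2) \<partial>M)"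

text \<open>A restart forgets the past, so the starting value of the martingale is \<open>0\<close>,
  and averaging \<open>b0\<close> independent centred terms divides the variance by
  \<open>b0\<close>.\<close>

lemma err_sq_restart:
  assumes "k < K" "q dvd k"
  shows "err_sq k \<le> ennreal (\<sigma>1\<^sup>2 / real b0)"
proof -
  let ?z = "\<lambda>\<omega> u. (1 / real b0) *\<^sub>R (grad (F u) (x k \<omega>) - g (x k \<omega>))"
  have x: "x k \<in> borel_measurable (past (before k 0))"
    using assms by (intro measurable_x_past) simp
  have "err_sq k = (\<integral>\<^sup>+\<omega>. ennreal ((norm (0 + (\<Sum>i<b0. ?z \<omega> (U k i \<omega>))))\<^sup>2) \<partial>M)"
    unfolding err_sq_def
  proof (rule nn_integral_cong)
    fix \<omega> assume "\<omega> \<in> space M"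
    then have v: "v k \<omega> = (1 / real b0) *\<^sub>R (\<Sum>i<b0. grad (F (U k i \<omega>)) (x k \<omega>))"
      using assms by (simp add: run.v_restart batch_grad_def)
    show "ennreal ((norm (v k \<omega> - g (x k \<omega>)))\<^sup>2)
        = ennreal ((norm (0 + (\<Sum>i<b0. ?z \<omega> (U k i \<omega>))))\<^sup>2)"
      unfolding v mean_diff_eq_sum[OF b0_pos] by simp
  qed
  also have "\<dots> \<le> (\<integral>\<^sup>+\<omega>. ennreal ((norm (0::real^'n))\<^sup>2) \<partial>M)
      + of_nat b0 * (\<integral>\<^sup>+\<omega>. ennreal ((1 / real b0)\<^sup>2 * \<sigma>1\<^sup>2) \<partial>M)"
  proof (rule nn_integral_batch_noise[where A = "\<lambda>_. 0" and z = ?z and n = b0])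
    show "case_prod ?z \<in> borel_measurable (past (before k 0) \<Otimes>\<^sub>M P)"
      using past_pair_measurable_grad[OF x] past_pair_measurable_objective_grad[OF x]
      unfolding case_prod_beta
      by (intro borel_measurable_scaleR borel_measurable_diff borel_measurable_const)
    fix \<omega>
    show "integrable P (?z \<omega>)" "(\<integral>u. ?z \<omega> u \<partial>P) = 0" "integrable P (\<lambda>u. (norm (?z \<omega> u))\<^sup>2)"
      using problem.grad_noise[of "x k \<omega>"] by (simp_all add: power_divide)
    show "(\<integral>u. (norm (?z \<omega> u))\<^sup>2 \<partial>P) \<le> (1 / real b0)\<^sup>2 * \<sigma>1\<^sup>2"
      unfolding norm_scaleR power_mult_distrib
      using problem.grad_noise(4)[of "x k \<omega>"] by (simp add: divide_right_mono power_divide)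
  qed (use assms in \<open>auto simp: batch_size_def\<close>)
  also have "\<dots> = ennreal (\<sigma>1\<^sup>2 / real b0)"
    using b0_pos
    by (simp add: run.emeasure_space_1 power2_eq_square ennreal_of_nat_eq_real_of_nat flip: ennreal_mult)
  finally show ?thesis .
qed

text \<open>The error is the previous error plus a centred batch average. The previous error is the
  starting value \<open>A\<close> of the martingale, and the new noise is that of gradient
  differences between consecutive iterates.\<close>

lemma err_sq_recursive:
  assumes "k < K" "\<not> q dvd k"
  shows "err_sq k \<le> err_sq (k - 1)
    + ennreal (L\<^sup>2 / real b) * (\<integral>\<^sup>+\<omega>. ennreal ((norm (x k \<omega> - x (k - 1) \<omega>))\<^sup>2) \<partial>M)"
proof -
  let ?A = "\<lambda>\<omega>. v (k - 1) \<omega> - g (x (k - 1) \<omega>)"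
  let ?z = "\<lambda>\<omega> u. (1 / real b) *\<^sub>R (grad (F u) (x k \<omega>) - grad (F u) (x (k - 1) \<omega>)
    - (g (x k \<omega>) - g (x (k - 1) \<omega>)))"
  let ?B = "\<lambda>\<omega>. (1 / real b)\<^sup>2 * (L\<^sup>2 * (norm (x k \<omega> - x (k - 1) \<omega>))\<^sup>2)"
  have "k - 1 < k" using assms(2) by (cases k) auto
  then have x: "x k \<in> borel_measurable (past (before k 0))"
      "x (k - 1) \<in> borel_measurable (past (before k 0))"
      "v (k - 1) \<in> borel_measurable (past (before k 0))"
    using measurable_x_v[of k] assms(1) by auto
  have x_run: "x k \<in> borel_measurable M" "x (k - 1) \<in> borel_measurable M"
    by (rule measurable_past_run[OF before_subset x(1)] measurable_past_run[OF before_subset x(2)])+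
  have "err_sq k = (\<integral>\<^sup>+\<omega>. ennreal ((norm (?A \<omega> + (\<Sum>i<b. ?z \<omega> (U k i \<omega>))))\<^sup>2) \<partial>M)"
    unfolding err_sq_def
  proof (rule nn_integral_cong)
    fix \<omega> assume "\<omega> \<in> space M"
    then have "v k \<omega> = (1 / real b) *\<^sub>R (\<Sum>i<b. grad (F (U k i \<omega>)) (x k \<omega>)
        - grad (F (U k i \<omega>)) (x (k - 1) \<omega>)) + v (k - 1) \<omega>"
      using assms by (simp add: run.v_recursive batch_grad_def sum_subtractf scaleR_diff_right)
    then have "v k \<omega> - g (x k \<omega>) = ?A \<omega> + ((1 / real b) *\<^sub>R (\<Sum>i<b. grad (F (U k i \<omega>)) (x k \<omega>)
        - grad (F (U k i \<omega>)) (x (k - 1) \<omega>)) - (g (x k \<omega>) - g (x (k - 1) \<omega>)))"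
      by simp
    then show "ennreal ((norm (v k \<omega> - g (x k \<omega>)))\<^sup>2)
        = ennreal ((norm (?A \<omega> + (\<Sum>i<b. ?z \<omega> (U k i \<omega>))))\<^sup>2)"
      by (simp only: mean_diff_eq_sum[OF b_pos])
  qed
  also have "\<dots> \<le> (\<integral>\<^sup>+\<omega>. ennreal ((norm (?A \<omega>))\<^sup>2) \<partial>M) + of_nat b * (\<integral>\<^sup>+\<omega>. ennreal (?B \<omega>) \<partial>M)"
  proof (rule nn_integral_batch_noise[where A = ?A and z = ?z and n = b and B = ?B])
    show "?A \<in> borel_measurable (past (before k 0))"
      using x(3) measurable_compose[OF x(2) problem.borel_measurable_grad_objective] by simp
    show "case_prod ?z \<in> borel_measurable (past (before k 0) \<Otimes>\<^sub>M P)"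
      using past_pair_measurable_grad[OF x(1)] past_pair_measurable_objective_grad[OF x(1)]
        past_pair_measurable_grad[OF x(2)] past_pair_measurable_objective_grad[OF x(2)]
      unfolding case_prod_beta
      by (intro borel_measurable_scaleR borel_measurable_diff borel_measurable_const)
    show "?B \<in> borel_measurable M" using x_run by measurable
    fix \<omega>
    show "integrable P (?z \<omega>)" "(\<integral>u. ?z \<omega> u \<partial>P) = 0" "integrable P (\<lambda>u. (norm (?z \<omega> u))\<^sup>2)"
      using problem.grad_difference_noise[of "x k \<omega>" "x (k - 1) \<omega>"]
      by (simp_all only: integrable_scaleR_right integral_scaleR_right norm_scaleR power_mult_distrib
          integrable_mult_right scaleR_zero_right)
    show "(\<integral>u. (norm (?z \<omega> u))\<^sup>2 \<partial>P) \<le> ?B \<omega>"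
      unfolding norm_scaleR power_mult_distrib
      using mult_left_mono[OF problem.grad_difference_noise(4)[of "x k \<omega>" "x (k - 1) \<omega>"],
        of "(1 / real b)\<^sup>2"] by simp
  qed (use assms in \<open>auto simp: batch_size_def\<close>)
  also have "of_nat b * (\<integral>\<^sup>+\<omega>. ennreal (?B \<omega>) \<partial>M)
      = ennreal (L\<^sup>2 / real b) * (\<integral>\<^sup>+\<omega>. ennreal ((norm (x k \<omega> - x (k - 1) \<omega>))\<^sup>2) \<partial>M)"
  proof -
    have "(\<integral>\<^sup>+\<omega>. ennreal (?B \<omega>) \<partial>M)
        = ennreal ((1 / real b)\<^sup>2 * L\<^sup>2) * (\<integral>\<^sup>+\<omega>. ennreal ((norm (x k \<omega> - x (k - 1) \<omega>))\<^sup>2) \<partial>M)"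
      using x_run by (subst nn_integral_cmult[symmetric]) (auto simp: ennreal_mult mult.assoc)
    moreover have "of_nat b * ennreal ((1 / real b)\<^sup>2 * L\<^sup>2) = ennreal (L\<^sup>2 / real b)"
      using b_pos by (simp add: power2_eq_square ennreal_of_nat_eq_real_of_nat flip: ennreal_mult)
    ultimately show ?thesis by (simp flip: mult.assoc)
  qed
  finally show ?thesis by (simp add: err_sq_def)
qed

lemma AE_hess_bounds:
  assumes "k < K"
  shows "AE \<omega> in M. loewner_le (mat smin) (hess_approx m \<delta> \<gamma>0 x v k \<omega>) \<and>
    loewner_le (hess_approx m \<delta> \<gamma>0 x v k \<omega>) (mat smax)"
  using bounded assms unfolding hess_approx_bounded_def by blast

text \<open>The step from \<open>k - 1\<close> to \<open>k\<close> has length at most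
  \<open>\<eta> * smax\<close> times the norm of the estimator used for it. The matrix bounds hold
  almost everywhere, which is enough under the integral.\<close>

lemma err_sq_step:
  assumes "k < K" "\<not> q dvd k"
  shows "err_sq k \<le> err_sq (k - 1) + ennreal (L\<^sup>2 * \<eta>\<^sup>2 * smax\<^sup>2 / real b) * est_sq (k - 1)"
proof -
  have k: "k - 1 < K" "Suc (k - 1) = k" using assms by (cases k; simp)+
  have v: "v (k - 1) \<in> borel_measurable M" using k by measurable
  have "(\<integral>\<^sup>+\<omega>. ennreal ((norm (x k \<omega> - x (k - 1) \<omega>))\<^sup>2) \<partial>M)
      \<le> (\<integral>\<^sup>+\<omega>. ennreal (\<eta>\<^sup>2 * smax\<^sup>2) * ennreal ((norm (v (k - 1) \<omega>))\<^sup>2) \<partial>M)"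
  proof (rule nn_integral_mono_AE, use AE_hess_bounds[OF k(1)] AE_space in eventually_elim)
    case (elim \<omega>)
    have "(norm (hess_approx m \<delta> \<gamma>0 x v (k - 1) \<omega> *v v (k - 1) \<omega>))\<^sup>2
        \<le> smax\<^sup>2 * (norm (v (k - 1) \<omega>))\<^sup>2"
      using elim smin_pos smax_pos by (intro loewner_bounds_norm[of smin]) auto
    then have "(norm (x k \<omega> - x (k - 1) \<omega>))\<^sup>2 \<le> \<eta>\<^sup>2 * (smax\<^sup>2 * (norm (v (k - 1) \<omega>))\<^sup>2)"
      using run.x_step[OF k(1) elim(2)] unfolding k(2)
      by (simp add: power_mult_distrib mult_left_mono)
    then show ?case by (simp add: mult.assoc flip: ennreal_mult)
  qed
  also have "\<dots> = ennreal (\<eta>\<^sup>2 * smax\<^sup>2) * est_sq (k - 1)"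
    unfolding est_sq_def using v by (intro nn_integral_cmult) auto
  finally have "ennreal (L\<^sup>2 / real b) * (\<integral>\<^sup>+\<omega>. ennreal ((norm (x k \<omega> - x (k - 1) \<omega>))\<^sup>2) \<partial>M)
      \<le> ennreal (L\<^sup>2 / real b) * (ennreal (\<eta>\<^sup>2 * smax\<^sup>2) * est_sq (k - 1))"
    by (rule mult_left_mono) simp
  also have "\<dots> = ennreal (L\<^sup>2 * \<eta>\<^sup>2 * smax\<^sup>2 / real b) * est_sq (k - 1)"
    by (simp add: mult.assoc flip: ennreal_mult mult.assoc[of "ennreal _"])
  finally show ?thesis using err_sq_recursive[OF assms] by (meson add_left_mono order_trans)
qed

section \<open>Mean descent, finiteness and the random output\<close>

lemma gap_nonneg: "0 \<le> objective P F y - (INF y. objective P F y)"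
  using cINF_lower[OF problem.bounded_below, of y] by simp

text \<open>Every term stands on the side where its coefficient is nonnegative, so the pointwise
  descent inequality integrates without subtracting possibly infinite means. Assumption
  \<open>c\<close> keeps the coefficient of \<open>est_sq k\<close> from being truncated by
  \<open>ennreal\<close>.\<close>

lemma gap_mean_step:
  assumes "k < K" and c: "0 \<le> \<eta> * smin / 2 - L * \<eta>\<^sup>2 * smax\<^sup>2 / 2"
  shows "gap_mean (Suc k) + ennreal (\<eta> * smin / 2) * grad_sq k
      + ennreal (\<eta> * smin / 2 - L * \<eta>\<^sup>2 * smax\<^sup>2 / 2) * est_sq k
    \<le> gap_mean k + ennreal (\<eta> * smax / 2) * err_sq k"
proof -
  let ?c = "\<eta> * smin / 2 - L * \<eta>\<^sup>2 * smax\<^sup>2 / 2"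
  let ?gap = "\<lambda>k \<omega>. objective P F (x k \<omega>) - (INF y. objective P F y)"
  have [measurable]: "x k \<in> borel_measurable M" "x (Suc k) \<in> borel_measurable M" "v k \<in> borel_measurable M"
    using \<open>k < K\<close> by auto
  have nonneg: "0 \<le> \<eta> * smin / 2" "0 \<le> \<eta> * smax / 2" using \<eta>_pos smin_pos smax_pos by auto
  have "gap_mean (Suc k) + ennreal (\<eta> * smin / 2) * grad_sq k + ennreal ?c * est_sq k
      = (\<integral>\<^sup>+\<omega>. ennreal (?gap (Suc k) \<omega> + \<eta> * smin / 2 * (norm (g (x k \<omega>)))\<^sup>2
          + ?c * (norm (v k \<omega>))\<^sup>2) \<partial>M)"
    unfolding gap_mean_def grad_sq_def est_sq_def
    by (subst nn_integral_add_scaled; (subst nn_integral_add_scaled)?)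
      (use nonneg(1) c gap_nonneg in \<open>auto intro!: add_nonneg_nonneg\<close>)
  also have "\<dots> \<le> (\<integral>\<^sup>+\<omega>. ennreal (?gap k \<omega> + \<eta> * smax / 2 * (norm (v k \<omega> - g (x k \<omega>)))\<^sup>2) \<partial>M)"
  proof (rule nn_integral_mono_AE, use AE_hess_bounds[OF \<open>k < K\<close>] AE_space in eventually_elim)
    case (elim \<omega>)
    then show ?case
      using quasi_newton_step_descent[OF problem.L_smooth_objective, of \<eta> smin
          "hess_approx m \<delta> \<gamma>0 x v k \<omega>" smax "x k \<omega>" "v k \<omega>"]
        run.x_step[OF \<open>k < K\<close> elim(2)] problem.L_pos \<eta>_pos smin_pos smax_pos
      by (intro ennreal_leI) simp
  qed
  also have "\<dots> = gap_mean k + ennreal (\<eta> * smax / 2) * err_sq k"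
    using nonneg(2) gap_nonneg unfolding gap_mean_def err_sq_def
    by (intro nn_integral_add_scaled) auto
  finally show ?thesis .
qed

lemma grad_sq_step:
  assumes "k < K"
  shows "grad_sq (Suc k) \<le> ennreal 2 * grad_sq k + ennreal (2 * (L\<^sup>2 * \<eta>\<^sup>2 * smax\<^sup>2)) * est_sq k"
proof -
  have [measurable]: "x k \<in> borel_measurable M" "v k \<in> borel_measurable M"
    using \<open>k < K\<close> by auto
  have "grad_sq (Suc k) \<le> (\<integral>\<^sup>+\<omega>. ennreal (2 * (norm (g (x k \<omega>)))\<^sup>2
      + 2 * (L\<^sup>2 * \<eta>\<^sup>2 * smax\<^sup>2) * (norm (v k \<omega>))\<^sup>2) \<partial>M)"
    unfolding grad_sq_def
  proof (rule nn_integral_mono_AE, use AE_hess_bounds[OF \<open>k < K\<close>] AE_space in eventually_elim)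
    case (elim \<omega>)
    then show ?case
      using quasi_newton_step_grad[OF problem.L_smooth_objective, of smin
          "hess_approx m \<delta> \<gamma>0 x v k \<omega>" smax "x k \<omega>" \<eta> "v k \<omega>"]
        run.x_step[OF \<open>k < K\<close> elim(2)] problem.L_pos smin_pos smax_pos
      by (intro ennreal_leI) simp
  qed
  also have "\<dots> = ennreal 2 * grad_sq k + ennreal (2 * (L\<^sup>2 * \<eta>\<^sup>2 * smax\<^sup>2)) * est_sq k"
    unfolding grad_sq_def est_sq_def
    by (simp add: nn_integral_add nn_integral_cmult ennreal_plus ennreal_mult)
  finally show ?thesis .
qed

text \<open>The iterates \<open>1\<close> to \<open>K\<close> are functions of the samples, of which
  \<open>\<zeta>\<close> is independent; they can therefore be frozen while the index is
  averaged.\<close>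

lemma nn_integral_output:
  "(\<integral>\<^sup>+\<omega>. ennreal ((norm (g (x (\<zeta> \<omega>) \<omega>)))\<^sup>2) \<partial>M) = (\<Sum>k\<in>{1..K}. grad_sq k) / of_nat K"
proof -
  let ?h = "\<lambda>\<omega> k. ennreal ((norm (g (x k \<omega>)))\<^sup>2)"
  have [measurable]: "x k \<in> borel_measurable (past S)" if "k \<in> {1..K}" for k
    using that measurable_past_mono[OF before_subset order_refl measurable_x_past] by simp
  have "(\<integral>\<^sup>+\<omega>. ?h \<omega> (\<zeta> \<omega>) \<partial>M)
      = (\<integral>\<^sup>+\<omega>. (\<integral>\<^sup>+k. ?h \<omega> k \<partial>distr M (count_space {1..K}) \<zeta>) \<partial>M)"
  proof (rule run.nn_integral_indep_subalgebra[OF subalgebra_past[OF order_refl]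
        run.output_measurable])
    show "run.indep_set (sets (past S)) (sets (vimage_algebra (space M) \<zeta> (count_space {1..K})))"
      using run.output_indep by (simp add: past_def)
    show "(\<lambda>(\<omega>, k). ?h \<omega> k) \<in> borel_measurable (past S \<Otimes>\<^sub>M count_space {1..K})"
      unfolding case_prod_beta
      by (rule measurable_compose_countable'[where I = "{1..K}" and g = snd]) auto
  qed
  also have "\<dots> = (\<integral>\<^sup>+\<omega>. (\<Sum>k\<in>{1..K}. ennreal (1 / real K) * ?h \<omega> k) \<partial>M)"
    unfolding run.output_distr uniform_count_measure_def
    by (simp add: nn_integral_point_measure_finite)
  also have "\<dots> = (\<Sum>k\<in>{1..K}. ennreal (1 / real K) * grad_sq k)"
    unfolding grad_sq_def
    by (subst nn_integral_sum) (auto intro!: sum.cong nn_integral_cmult)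
  also have "\<dots> = (\<Sum>k\<in>{1..K}. grad_sq k) / of_nat K"
    using K_pos by (simp add: sum_distrib_left[symmetric] divide_ennreal_def mult.commute
        ennreal_of_nat_eq_real_of_nat inverse_ennreal divide_inverse)
  finally show ?thesis .
qed

lemma gap_mean_0: "gap_mean 0 = ennreal (objective P F x0 - (INF y. objective P F y))"
proof -
  have "gap_mean 0 = (\<integral>\<^sup>+\<omega>. ennreal (objective P F x0 - (INF y. objective P F y)) \<partial>M)"
    unfolding gap_mean_def by (intro nn_integral_cong) (simp add: run.x_init)
  then show ?thesis by (simp add: run.emeasure_space_1)
qed

text \<open>The error is finite by its restart bound or its recursion; then the right-hand side of
  \<open>gap_mean_step\<close> is finite and controls each mean on the left. Strict positivity of
  the coefficients is essential, as a zero factor would allow an infinite mean.\<close>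

lemma finite_means:
  assumes c: "0 < \<eta> * smin / 2 - L * \<eta>\<^sup>2 * smax\<^sup>2 / 2" and "k \<le> K"
  shows "gap_mean k < \<infinity> \<and> (\<forall>j<k. err_sq j < \<infinity> \<and> est_sq j < \<infinity> \<and> grad_sq j < \<infinity>)"
  using \<open>k \<le> K\<close>
proof (induction k)
  case 0
  then show ?case by (simp add: gap_mean_0)
next
  case (Suc k)
  then have "k < K" and IH: "gap_mean k < \<infinity>"
      "\<And>j. j < k \<Longrightarrow> err_sq j < \<infinity> \<and> est_sq j < \<infinity> \<and> grad_sq j < \<infinity>"
    by auto
  have err: "err_sq k < \<infinity>"
  proof (cases "q dvd k")
    case True
    then show ?thesis using err_sq_restart[OF \<open>k < K\<close>] by (auto intro: le_less_trans)
  next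
    case False
    then have "k - 1 < k" by (cases k) auto
    from IH(2)[OF this]
    have "err_sq (k - 1) + ennreal (L\<^sup>2 * \<eta>\<^sup>2 * smax\<^sup>2 / real b) * est_sq (k - 1) < \<infinity>"
      by (simp add: ennreal_mult_less_top)
    then show ?thesis using err_sq_step[OF \<open>k < K\<close> False] by (rule le_less_trans[rotated])
  qed
  then have "gap_mean k + ennreal (\<eta> * smax / 2) * err_sq k < \<infinity>"
    using IH(1) by (simp add: ennreal_mult_less_top)
  then have "gap_mean (Suc k) + ennreal (\<eta> * smin / 2) * grad_sq k
      + ennreal (\<eta> * smin / 2 - L * \<eta>\<^sup>2 * smax\<^sup>2 / 2) * est_sq k < \<infinity>"
    by (rule le_less_trans[OF gap_mean_step[OF \<open>k < K\<close> less_imp_le[OF c]]])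
  then have "gap_mean (Suc k) < \<infinity> \<and> est_sq k < \<infinity> \<and> grad_sq k < \<infinity>"
    using c mult_pos_pos[OF \<eta>_pos smin_pos] by (auto simp: ennreal_mult_less_top ennreal_eq_0_iff)
  then show ?case using err IH(2) by (auto simp: less_Suc_eq)
qed

text \<open>The bound on \<open>\<alpha>\<close> says that the gradients at consecutive iterates are comparable, which
  shifts the bound from the iterates \<open>0, \<dots>, K - 1\<close> to the range \<open>1, \<dots>, K\<close> of the output index.\<close>

lemma sum_grad_sq_le:
  fixes \<epsilon> :: real
  defines "\<alpha> \<equiv> L\<^sup>2 * \<eta>\<^sup>2 * smax\<^sup>2"
  defines "\<beta> \<equiv> \<eta> * smin / 2 - L * \<eta>\<^sup>2 * smax\<^sup>2 / 2 - \<eta> * smax / 2 * \<alpha>"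
  assumes "b = q" "0 < \<beta>" "\<alpha> \<le> 1"
    and noise: "\<eta> * smax / 2 * (\<sigma>1\<^sup>2 / real b0) \<le> \<beta> * \<epsilon>\<^sup>2 / 4"
    and gap: "objective P F x0 - (INF y. objective P F y) \<le> real K * (\<beta> * \<epsilon>\<^sup>2 / 4)"
  shows "(\<Sum>k\<in>{1..K}. grad_sq k) \<le> ennreal (real K * \<epsilon>\<^sup>2)"
proof -
  define \<Gamma> where "\<Gamma> k = enn2real (gap_mean k)" for k
  define G where "G k = enn2real (grad_sq k)" for k
  define V where "V k = enn2real (est_sq k)" for k
  define e where "e k = enn2real (err_sq k)" for k
  let ?A = "\<eta> * smin / 2" and ?D = "\<eta> * smax / 2"
  have \<alpha>_nonneg: "0 \<le> \<alpha>" by (simp add: \<alpha>_def)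
  have pos: "0 < ?A" "0 < ?D" using \<eta>_pos smin_pos smax_pos by auto
  \<comment> \<open>This brings the coefficient of the squared estimator into the split form
    expected by \<open>spider_recursion\<close>.\<close>
  have c: "\<eta> * smin / 2 - L * \<eta>\<^sup>2 * smax\<^sup>2 / 2 = \<beta> + ?D * \<alpha>" by (simp add: \<beta>_def)
  have c_pos: "0 < \<beta> + ?D * \<alpha>" using \<open>0 < \<beta>\<close> pos \<alpha>_nonneg by (intro add_pos_nonneg) auto
  have "\<beta> \<le> ?A" using c problem.L_pos pos \<alpha>_nonneg
    by (smt (verit) divide_nonneg_nonneg mult_nonneg_nonneg zero_le_power2)
  \<comment> \<open>Finiteness allows the passage from \<open>ennreal\<close> to real numbers, where
    the telescoping differences make sense.\<close>
  note finite = finite_means[unfolded c, OF c_pos]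
  have \<Gamma>: "gap_mean k = ennreal (\<Gamma> k)" if "k \<le> K" for k
    using finite[OF that] by (simp add: \<Gamma>_def)
  have real: "grad_sq k = ennreal (G k)" "est_sq k = ennreal (V k)" "err_sq k = ennreal (e k)" if "k < K" for k
    using finite[of "Suc k"] that by (auto simp: G_def V_def e_def)
  have nonneg: "0 \<le> \<Gamma> k" "0 \<le> G k" "0 \<le> V k" "0 \<le> e k" for k
    by (simp_all add: \<Gamma>_def G_def V_def e_def)
  have "?A * (\<Sum>k<K. G k) + \<beta> * (\<Sum>k<K. V k) \<le> \<Gamma> 0 + ?D * (real K * (\<sigma>1\<^sup>2 / real b0))"
  proof (rule spider_recursion[OF q_pos nonneg(1,3) \<alpha>_nonneg])
    fix k assume "k < K"
    show "\<Gamma> (Suc k) + ?A * G k + (\<beta> + ?D * \<alpha>) * V k \<le> \<Gamma> k + ?D * e k"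
      using gap_mean_step[unfolded c, OF \<open>k < K\<close>] c_pos pos nonneg \<open>k < K\<close>
      by (simp add: \<Gamma> real less_imp_le add_nonneg_nonneg mult_nonneg_nonneg
          del: ennreal_plus flip: ennreal_mult ennreal_plus)
  next
    fix k assume "k < K" "q dvd k"
    then show "e k \<le> \<sigma>1\<^sup>2 / real b0"
      using err_sq_restart[of k] by (simp add: real)
  next
    fix k assume k: "k < K" "\<not> q dvd k"
    then have "k - 1 < K" by simp
    have "ennreal (e (k - 1) + \<alpha> / real q * V (k - 1))
        = ennreal (e (k - 1)) + ennreal (\<alpha> / real q) * ennreal (V (k - 1))"
      using \<alpha>_nonneg nonneg
      by (simp only: ennreal_plus ennreal_mult mult_nonneg_nonneg divide_nonneg_nonneg of_nat_0_le_iff)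
    then have "ennreal (e k) \<le> ennreal (e (k - 1) + \<alpha> / real q * V (k - 1))"
      using err_sq_step[OF k, folded \<alpha>_def] \<open>b = q\<close>
      by (simp only: real[OF \<open>k < K\<close>] real[OF \<open>k - 1 < K\<close>])
    then show "e k \<le> e (k - 1) + \<alpha> / real q * V (k - 1)"
      using \<alpha>_nonneg nonneg by (subst (asm) ennreal_le_iff) (auto intro!: add_nonneg_nonneg)
  qed (use pos in auto)
  moreover have "\<Gamma> 0 = objective P F x0 - (INF y. objective P F y)"
    using gap_mean_0 gap_nonneg by (simp add: \<Gamma>_def)
  moreover have "?D * (real K * (\<sigma>1\<^sup>2 / real b0)) \<le> real K * (\<beta> * \<epsilon>\<^sup>2 / 4)"
    using mult_left_mono[OF noise, of "real K"] by (simp add: algebra_simps)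
  moreover have "\<beta> * (\<Sum>k<K. G k) \<le> ?A * (\<Sum>k<K. G k)"
    using \<open>\<beta> \<le> ?A\<close> nonneg by (intro mult_right_mono sum_nonneg) auto
  \<comment> \<open>The initial gap and the restart noise contribute one quarter each.\<close>
  ultimately have "\<beta> * (\<Sum>k<K. G k) + \<beta> * (\<Sum>k<K. V k) \<le> 2 * (real K * (\<beta> * \<epsilon>\<^sup>2 / 4))"
    using gap by linarith
  then have "\<beta> * ((\<Sum>k<K. G k) + (\<Sum>k<K. V k)) \<le> \<beta> * (real K * \<epsilon>\<^sup>2 / 2)"
    by (simp add: algebra_simps)
  then have GV: "(\<Sum>k<K. G k) + (\<Sum>k<K. V k) \<le> real K * \<epsilon>\<^sup>2 / 2"
    using \<open>0 < \<beta>\<close> by (simp only: mult_le_cancel_left_pos)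
  have "(\<Sum>k\<in>{1..K}. grad_sq k) = (\<Sum>k<K. grad_sq (Suc k))"
    by (simp add: sum.atLeast1_atMost_eq)
  also have "\<dots> \<le> (\<Sum>k<K. ennreal (2 * G k + 2 * \<alpha> * V k))"
  proof (rule sum_mono)
    fix k assume "k \<in> {..<K}"
    then have "k < K" by simp
    show "grad_sq (Suc k) \<le> ennreal (2 * G k + 2 * \<alpha> * V k)"
      using grad_sq_step[OF \<open>k < K\<close>] nonneg \<alpha>_nonneg
      by (simp add: real[OF \<open>k < K\<close>] \<alpha>_def[symmetric] ennreal_mult ennreal_plus)
  qed
  also have "\<dots> = ennreal (\<Sum>k<K. 2 * G k + 2 * \<alpha> * V k)"
    using nonneg \<alpha>_nonneg by (intro sum_ennreal) auto
  also have "\<dots> \<le> ennreal (real K * \<epsilon>\<^sup>2)"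
  proof (rule ennreal_leI)
    \<comment> \<open>The factor \<open>2\<close> caused by the index shift uses up the remaining
      half in \<open>GV\<close>, and \<open>\<alpha> \<le> 1\<close> lets the \<open>V\<close> terms
      be treated like the \<open>G\<close> terms.\<close>
    have "(\<Sum>k<K. 2 * G k + 2 * \<alpha> * V k) = 2 * (\<Sum>k<K. G k) + 2 * (\<alpha> * (\<Sum>k<K. V k))"
      by (simp add: sum.distrib sum_distrib_left mult.assoc)
    moreover have "\<alpha> * (\<Sum>k<K. V k) \<le> 1 * (\<Sum>k<K. V k)"
      using \<open>\<alpha> \<le> 1\<close> nonneg by (intro mult_right_mono sum_nonneg) auto
    ultimately show "(\<Sum>k<K. 2 * G k + 2 * \<alpha> * V k) \<le> real K * \<epsilon>\<^sup>2" using GV by simp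
  qed
  finally show ?thesis .
qed

lemma expected_output_grad_le:
  assumes "0 < \<epsilon>" and sum: "(\<Sum>k\<in>{1..K}. grad_sq k) \<le> ennreal (real K * \<epsilon>\<^sup>2)"
  shows "integrable M (\<lambda>\<omega>. norm (g (x (\<zeta> \<omega>) \<omega>)))"
    "(\<integral>\<omega>. norm (g (x (\<zeta> \<omega>) \<omega>)) \<partial>M) \<le> \<epsilon>"
proof -
  define h where "h \<omega> = norm (g (x (\<zeta> \<omega>) \<omega>))" for \<omega>
  have "(\<lambda>\<omega>. x (\<zeta> \<omega>) \<omega>) \<in> borel_measurable M"
    by (rule measurable_compose_countable'[where f = x, OF _ run.output_measurable]) auto
  then have h [measurable]: "h \<in> borel_measurable M"
    unfolding h_def by measurable
  have "(\<integral>\<^sup>+\<omega>. ennreal ((h \<omega>)\<^sup>2) \<partial>M) \<le> ennreal (real K * \<epsilon>\<^sup>2) / of_nat K"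
    unfolding h_def nn_integral_output by (rule divide_right_mono_ennreal[OF sum])
  also have "\<dots> = ennreal (\<epsilon>\<^sup>2)"
    using K_pos by (simp add: ennreal_of_nat_eq_real_of_nat divide_ennreal)
  finally have sq_le: "(\<integral>\<^sup>+\<omega>. ennreal ((h \<omega>)\<^sup>2) \<partial>M) \<le> ennreal (\<epsilon>\<^sup>2)" .
  then have sq: "integrable M (\<lambda>\<omega>. (h \<omega>)\<^sup>2)"
    by (intro integrableI_bounded) (auto intro: le_less_trans)
  have "ennreal (\<integral>\<omega>. (h \<omega>)\<^sup>2 \<partial>M) \<le> ennreal (\<epsilon>\<^sup>2)"
    using sq_le nn_integral_eq_integral[OF sq] by simp
  then have mean: "(\<integral>\<omega>. (h \<omega>)\<^sup>2 \<partial>M) \<le> \<epsilon>\<^sup>2" by (simp add: ennreal_le_iff)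
  \<comment> \<open>This replaces Jensen: it bounds the square root by its tangent at
    \<open>\<epsilon>\<^sup>2\<close>. The same inequality yields integrability of
    \<open>h\<close>.\<close>
  have amgm: "h \<omega> \<le> \<epsilon> / 2 + (h \<omega>)\<^sup>2 / (2 * \<epsilon>)" for \<omega>
    using \<open>0 < \<epsilon>\<close> zero_le_power2[of "h \<omega> - \<epsilon>"] by (simp add: power2_eq_square field_simps)
  have bound: "integrable M (\<lambda>\<omega>. \<epsilon> / 2 + (h \<omega>)\<^sup>2 / (2 * \<epsilon>))" using sq by simp
  then have int: "integrable M h"
    using h by (rule Bochner_Integration.integrable_bound)
      (use amgm in \<open>auto simp: h_def intro: order_trans[OF _ abs_ge_self]\<close>)
  have "(\<integral>\<omega>. h \<omega> \<partial>M) \<le> (\<integral>\<omega>. \<epsilon> / 2 + (h \<omega>)\<^sup>2 / (2 * \<epsilon>) \<partial>M)"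
    using int bound amgm by (rule integral_mono)
  also have "\<dots> = \<epsilon> / 2 + (\<integral>\<omega>. (h \<omega>)\<^sup>2 \<partial>M) / (2 * \<epsilon>)"
    using sq by (simp add: run.prob_space)
  also have "\<dots> \<le> \<epsilon> / 2 + \<epsilon>\<^sup>2 / (2 * \<epsilon>)"
    using mean \<open>0 < \<epsilon>\<close> by (intro add_left_mono divide_right_mono) auto
  also have "\<dots> = \<epsilon>" using \<open>0 < \<epsilon>\<close> by (simp add: power2_eq_square)
  finally show "(\<integral>\<omega>. norm (g (x (\<zeta> \<omega>) \<omega>)) \<partial>M) \<le> \<epsilon>" by (simp add: h_def)
  show "integrable M (\<lambda>\<omega>. norm (g (x (\<zeta> \<omega>) \<omega>)))" using int by (simp add: h_def[abs_def])
qed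

end

section \<open>Parameters and complexity\<close>

lemma step_size_pos:
  assumes "0 < L" "0 < smin" "smin < smax"
  shows "0 < step_size L smin smax"
  using assms by (simp add: step_size_def add_pos_pos)

text \<open>With \<open>t = L * \<eta> * smax = r / \<phi>\<close>, where \<open>r = smin / smax\<close> and \<open>\<phi>\<close> is the golden ratio,
  \<open>\<beta>\<^sup>*\<close> is \<open>\<eta> * smax / 2\<close> times \<open>r - t - t\<^sup>2 = (r - r\<^sup>2) / \<phi>\<^sup>2\<close>.\<close>

lemma beta_star_pos:
  assumes "0 < L" "0 < smin" "smin < smax"
  shows "0 < beta_star L smin smax" "L * step_size L smin smax * smax \<le> 1"
proof -
  define \<eta> where "\<eta> = step_size L smin smax"
  define \<phi> where "\<phi> = (1 + sqrt 5) / 2"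
  define r where "r = smin / smax"
  have r: "0 < r" "r < 1" using assms by (auto simp: r_def)
  have "0 < \<phi>" "1 \<le> \<phi>" and \<phi>: "\<phi>\<^sup>2 = \<phi> + 1"
    by (auto simp: \<phi>_def power2_eq_square field_simps add_pos_pos)
  have \<eta>_eq: "\<eta> = smin / (\<phi> * L * smax\<^sup>2)"
    by (simp add: \<eta>_def step_size_def \<phi>_def)
  have t: "L * \<eta> * smax = r / \<phi>"
    using assms \<open>0 < \<phi>\<close> by (simp add: \<eta>_eq r_def power2_eq_square field_simps)
  have "r / \<phi> \<le> 1" using r \<open>1 \<le> \<phi>\<close> by (simp add: divide_le_eq)
  then show "L * step_size L smin smax * smax \<le> 1" using t by (simp add: \<eta>_def)
  have "beta_star L smin smax
      = \<eta> * smax / 2 * (smin / smax - L * \<eta> * smax - (L * \<eta> * smax)\<^sup>2)"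
    using assms by (simp add: beta_star_def Let_def \<eta>_def[symmetric] power2_eq_square power3_eq_cube field_simps)
  also have "smin / smax - L * \<eta> * smax - (L * \<eta> * smax)\<^sup>2 = (r * \<phi>\<^sup>2 - r * \<phi> - r\<^sup>2) / \<phi>\<^sup>2"
    unfolding t r_def[symmetric] using \<open>0 < \<phi>\<close> by (simp add: power2_eq_square field_simps)
  \<comment> \<open>The golden ratio satisfies \<open>\<phi>\<^sup>2 = \<phi> + 1\<close>, which
    leaves the factor \<open>1 - r\<close>, positive because \<open>smin < smax\<close> is
    strict.\<close>
  also have "\<dots> = r * (1 - r) / \<phi>\<^sup>2"
    unfolding \<phi> by (simp add: power2_eq_square algebra_simps)
  finally show "0 < beta_star L smin smax"
    using r assms \<open>0 < \<phi>\<close> step_size_pos[of L smin smax] by (simp add: \<eta>_def)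
qed

text \<open>Rounding up preserves the lower bound that pays for the restart noise; the upper bound,
  with \<open>1\<close> added for the rounding, serves the complexity count.\<close>

lemma epoch_length_bounds:
  assumes "0 < L" "0 < smin" "smin < smax" "0 < \<sigma>1" "0 < \<epsilon>"
  defines "\<eta> \<equiv> step_size L smin smax" and "\<beta> \<equiv> beta_star L smin smax"
  defines "C \<equiv> \<eta> * smax / \<beta> + 2 + L\<^sup>2 * \<eta>^3 * smax^3 / \<beta>"
  shows "0 < epoch_length L smin smax \<sigma>1 \<epsilon>"
    "C * (2 * \<sigma>1\<^sup>2 / \<epsilon>\<^sup>2) \<le> (real (epoch_length L smin smax \<sigma>1 \<epsilon>))\<^sup>2"
    "real (epoch_length L smin smax \<sigma>1 \<epsilon>) \<le> sqrt (2 * C * \<sigma>1\<^sup>2) / \<epsilon> + 1"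
proof -
  have "0 < \<eta>" "0 < \<beta>" using assms step_size_pos beta_star_pos by auto
  then have "0 < C" unfolding C_def using assms by (intro add_pos_pos) auto
  define Q where "Q = C * (2 * \<sigma>1\<^sup>2 / \<epsilon>\<^sup>2)"
  have "0 < Q" using \<open>0 < C\<close> assms by (simp add: Q_def)
  have q: "epoch_length L smin smax \<sigma>1 \<epsilon> = nat \<lceil>sqrt Q\<rceil>"
    by (simp add: epoch_length_def Let_def Q_def C_def \<eta>_def \<beta>_def)
  show "0 < epoch_length L smin smax \<sigma>1 \<epsilon>" using \<open>0 < Q\<close> by (simp add: q)
  have "sqrt Q \<le> real (nat \<lceil>sqrt Q\<rceil>)" by (rule real_nat_ceiling_ge)
  then have "(sqrt Q)\<^sup>2 \<le> (real (nat \<lceil>sqrt Q\<rceil>))\<^sup>2" using \<open>0 < Q\<close> by (intro power_mono) auto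
  then show "Q \<le> (real (epoch_length L smin smax \<sigma>1 \<epsilon>))\<^sup>2" using \<open>0 < Q\<close> by (simp add: q)
  have "sqrt Q = sqrt (2 * C * \<sigma>1\<^sup>2) / \<epsilon>"
    using \<open>0 < \<epsilon>\<close> by (simp add: Q_def real_sqrt_mult real_sqrt_divide)
  moreover have "real (nat \<lceil>sqrt Q\<rceil>) \<le> sqrt Q + 1"
    using \<open>0 < Q\<close> by (simp add: of_nat_ceiling le_of_int_ceiling ceiling_correct less_imp_le)
  ultimately show "real (epoch_length L smin smax \<sigma>1 \<epsilon>) \<le> sqrt (2 * C * \<sigma>1\<^sup>2) / \<epsilon> + 1"
    by (simp add: q)
qed

text \<open>A restart costs \<open>q\<^sup>2\<close>, which over an epoch is \<open>q\<close> per
  iteration, the order of the recursive steps. There are at most \<open>K div q + 1\<close>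
  restarts, the extra one accounting for an incomplete epoch and for the term
  \<open>q\<^sup>2\<close>.\<close>

lemma sfo_calls_le:
  assumes "0 < q"
  shows "sfo_calls q (q\<^sup>2) q K \<le> 3 * q * K + q\<^sup>2"
proof -
  have sub: "{k. k < K \<and> q dvd k} \<subseteq> (\<lambda>i. q * i) ` {..K div q}"
    using assms by (auto elim!: dvdE simp: div_le_mono less_eq_div_iff_mult_less_eq mult.commute)
  have "card {k. k < K \<and> q dvd k} \<le> K div q + 1"
    using card_mono[OF _ sub] card_image_le[of "{..K div q}" "\<lambda>i. q * i"] by simp
  then have "card {k. k < K \<and> q dvd k} * q\<^sup>2 \<le> (K div q + 1) * q\<^sup>2" by (rule mult_right_mono) simp
  also have "\<dots> = (K div q * q) * q + q\<^sup>2" by (simp add: power2_eq_square algebra_simps)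
  also have "\<dots> \<le> K * q + q\<^sup>2" by (intro add_right_mono mult_right_mono) auto
  finally have "card {k. k < K \<and> q dvd k} * q\<^sup>2 \<le> K * q + q\<^sup>2" .
  moreover have "(\<Sum>k<K. if q dvd k then q\<^sup>2 else 0) = card {k. k < K \<and> q dvd k} * q\<^sup>2"
    by (simp add: sum.If_cases Int_def lessThan_def)
  moreover have "sfo_calls q (q\<^sup>2) q K \<le> (\<Sum>k<K. (if q dvd k then q\<^sup>2 else 0) + 2 * q)"
    unfolding sfo_calls_def by (intro sum_mono) auto
  ultimately show ?thesis by (simp add: sum.distrib algebra_simps)
qed

text \<open>The epoch length is of order \<open>1 / \<epsilon>\<close> and \<open>K\<close> of order
  \<open>1 / \<epsilon>\<^sup>2\<close>, so \<open>3 * q * K + q\<^sup>2\<close> is of the claimed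
  order. The maximum with \<open>1\<close> leaves room for a positive number of iterations when
  \<open>\<Delta>\<close> is zero.\<close>

lemma sfo_complexity:
  fixes K :: "real \<Rightarrow> nat"
  assumes "0 < L" "0 < smin" "smin < smax" "0 < \<sigma>1"
    and K: "(\<lambda>\<epsilon>. real (K \<epsilon>)) \<in> O[at_right 0](\<lambda>\<epsilon>. max 1 (\<Delta> / \<epsilon>\<^sup>2))"
  defines "q \<equiv> epoch_length L smin smax \<sigma>1"
  shows "(\<lambda>\<epsilon>. real (sfo_calls (q \<epsilon>) ((q \<epsilon>)\<^sup>2) (q \<epsilon>) (K \<epsilon>))) \<in> O[at_right 0](\<lambda>\<epsilon>. 1 / \<epsilon>^3)"
proof -
  \<comment> \<open>For \<open>\<epsilon> < 1\<close> additive constants and lower powers of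
    \<open>1 / \<epsilon>\<close> are absorbed.\<close>
  have small: "eventually (\<lambda>\<epsilon>. 0 < \<epsilon> \<and> \<epsilon> < (1::real)) (at_right 0)"
    by (auto simp: eventually_at_right_field intro: exI[of _ 1])
  obtain C where C: "\<And>\<epsilon>. 0 < \<epsilon> \<Longrightarrow> real (q \<epsilon>) \<le> C / \<epsilon> + 1"
    using epoch_length_bounds(3)[OF assms(1-4)] unfolding q_def by blast
  have q: "(\<lambda>\<epsilon>. real (q \<epsilon>)) \<in> O[at_right 0](\<lambda>\<epsilon>. 1 / \<epsilon>)"
  proof (rule bigoI[of _ "C + 1"], use small in eventually_elim)
    case (elim \<epsilon>)
    then have "1 \<le> 1 / \<epsilon>" by simp
    then have "real (q \<epsilon>) \<le> C / \<epsilon> + 1 / \<epsilon>" using C[of \<epsilon>] elim by linarith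
    then show ?case using elim by (simp add: add_divide_distrib)
  qed
  have "(\<lambda>\<epsilon>. max 1 (\<Delta> / \<epsilon>\<^sup>2)) \<in> O[at_right 0](\<lambda>\<epsilon>. 1 / \<epsilon>\<^sup>2)"
  proof (rule bigoI[of _ "max 1 \<Delta>"], use small in eventually_elim)
    case (elim \<epsilon>)
    then have "1 \<le> 1 / \<epsilon>\<^sup>2" by (simp add: power_le_one)
    also have "\<dots> \<le> max 1 \<Delta> * (1 / \<epsilon>\<^sup>2)" using elim by (simp add: divide_right_mono)
    finally show ?case by (simp add: divide_right_mono)
  qed
  with K have K': "(\<lambda>\<epsilon>. real (K \<epsilon>)) \<in> O[at_right 0](\<lambda>\<epsilon>. 1 / \<epsilon>\<^sup>2)"
    by (rule landau_o.big_trans)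
  have "(\<lambda>\<epsilon>. real (q \<epsilon>) * real (K \<epsilon>)) \<in> O[at_right 0](\<lambda>\<epsilon>. 1 / \<epsilon> * (1 / \<epsilon>\<^sup>2))"
    by (rule landau_o.big.mult[OF q K'])
  then have qK: "(\<lambda>\<epsilon>. real (q \<epsilon>) * real (K \<epsilon>)) \<in> O[at_right 0](\<lambda>\<epsilon>. 1 / \<epsilon>^3)"
    by (simp add: power2_eq_square power3_eq_cube mult.assoc)
  have "(\<lambda>\<epsilon>. real (q \<epsilon>) * real (q \<epsilon>)) \<in> O[at_right 0](\<lambda>\<epsilon>. 1 / \<epsilon> * (1 / \<epsilon>))"
    by (rule landau_o.big.mult[OF q q])
  also have "(\<lambda>\<epsilon>::real. 1 / \<epsilon> * (1 / \<epsilon>)) \<in> O[at_right 0](\<lambda>\<epsilon>. 1 / \<epsilon>^3)"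
  proof (rule bigoI[of _ 1], use small in eventually_elim)
    case (elim \<epsilon>)
    then show ?case by (simp add: power3_eq_cube field_simps)
  qed
  finally have "(\<lambda>\<epsilon>. 3 * (real (q \<epsilon>) * real (K \<epsilon>)) + real (q \<epsilon>) * real (q \<epsilon>)) \<in> O[at_right 0](\<lambda>\<epsilon>. 1 / \<epsilon>^3)"
    using qK by (intro sum_in_bigo) simp_all
  moreover have "(\<lambda>\<epsilon>. real (sfo_calls (q \<epsilon>) ((q \<epsilon>)\<^sup>2) (q \<epsilon>) (K \<epsilon>)))
      \<in> O[at_right 0](\<lambda>\<epsilon>. 3 * (real (q \<epsilon>) * real (K \<epsilon>)) + real (q \<epsilon>) * real (q \<epsilon>))"
  proof (rule bigoI[of _ 1], use small in eventually_elim)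
    case (elim \<epsilon>)
    then have "0 < q \<epsilon>" using epoch_length_bounds(1)[OF assms(1-4)] by (simp add: q_def)
    from sfo_calls_le[OF this, of "K \<epsilon>"]
    have "real (sfo_calls (q \<epsilon>) ((q \<epsilon>)\<^sup>2) (q \<epsilon>) (K \<epsilon>)) \<le> real (3 * q \<epsilon> * K \<epsilon> + (q \<epsilon>)\<^sup>2)"
      by (simp only: of_nat_le_iff)
    then show ?case by (simp add: power2_eq_square)
  qed
  ultimately show ?thesis by (rule landau_o.big_trans[rotated])
qed

section \<open>Accuracy and complexity for the prescribed parameters\<close>

theorem theorem4:
  fixes P :: "'u measure" and F :: "'u \<Rightarrow> real^'n \<Rightarrow> real"
    and L \<kappa> smin smax \<sigma>1 \<delta> \<gamma>0 :: real and m :: nat and x0 :: "real^'n"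
  assumes problem: "online_problem P F L \<kappa> \<sigma>1"
    and bounds: "0 < smin" "smin < smax"
    and delta: "0 < \<delta>"
  shows
    "0 < iteration_const L smin smax \<and>
     (\<forall>(\<epsilon>::real) K (M :: 'w measure) U \<zeta> x v.
        0 < \<epsilon> \<and> 1 \<le> K \<and>
        spider_sqn_run M P F x0 (step_size L smin smax)
          (epoch_length L smin smax \<sigma>1 \<epsilon>) ((epoch_length L smin smax \<sigma>1 \<epsilon>)\<^sup>2)
          (epoch_length L smin smax \<sigma>1 \<epsilon>) m \<delta> \<gamma>0 K U \<zeta> x v \<and>
        hess_approx_bounded M smin smax m \<delta> \<gamma>0 K x v \<and>
        hess_approx_dependence M P
          (epoch_length L smin smax \<sigma>1 \<epsilon>) ((epoch_length L smin smax \<sigma>1 \<epsilon>)\<^sup>2)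
          (epoch_length L smin smax \<sigma>1 \<epsilon>) m \<delta> \<gamma>0 K U x v \<and>
        real K \<ge> iteration_const L smin smax
                  * ((objective P F x0 - (INF y. objective P F y)) / \<epsilon>\<^sup>2)
        \<longrightarrow> integrable M (\<lambda>\<omega>. norm (grad (objective P F) (x (\<zeta> \<omega>) \<omega>))) \<and>
            (\<integral>\<omega>. norm (grad (objective P F) (x (\<zeta> \<omega>) \<omega>)) \<partial>M) \<le> \<epsilon>) \<and>
     (\<forall>K :: real \<Rightarrow> nat.
        (\<lambda>\<epsilon>. real (K \<epsilon>)) \<in> O[at_right 0](
          \<lambda>\<epsilon>. max 1 ((objective P F x0 - (INF y. objective P F y)) / \<epsilon>\<^sup>2))
        \<longrightarrow> (\<lambda>\<epsilon>. real (sfo_calls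
               (epoch_length L smin smax \<sigma>1 \<epsilon>) ((epoch_length L smin smax \<sigma>1 \<epsilon>)\<^sup>2)
               (epoch_length L smin smax \<sigma>1 \<epsilon>) (K \<epsilon>)))
            \<in> O[at_right 0](\<lambda>\<epsilon>. 1 / \<epsilon>^3))"
  proof -
  interpret problem: online_problem P F L \<kappa> \<sigma>1 by (rule problem)
  define \<eta> where "\<eta> = step_size L smin smax"
  define \<beta> where "\<beta> = beta_star L smin smax"
  define \<alpha> where "\<alpha> = L\<^sup>2 * \<eta>\<^sup>2 * smax\<^sup>2"
  define \<Delta> where "\<Delta> = objective P F x0 - (INF y. objective P F y)"
  note params = problem.L_pos bounds
  have \<eta>: "0 < \<eta>" and \<beta>: "0 < \<beta>" and smax: "0 < smax"
    using step_size_pos[OF params] beta_star_pos[OF params] bounds by (auto simp: \<eta>_def \<beta>_def)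
  have "0 \<le> L * \<eta> * smax" "L * \<eta> * smax \<le> 1"
    using beta_star_pos(2)[OF params] problem.L_pos \<eta> smax by (auto simp: \<eta>_def)
  then have "\<alpha> \<le> 1" using power_le_one[of "L * \<eta> * smax" 2] by (simp add: \<alpha>_def power_mult_distrib)
  have "0 \<le> \<alpha>" by (simp add: \<alpha>_def)
  \<comment> \<open>The cubic term of \<open>beta_star\<close> is the coefficient
    \<open>\<eta> * smax / 2\<close> of the error times \<open>\<alpha>\<close>, that is, the amount
    consumed by the accumulated estimator error.\<close>
  have \<beta>_eq: "\<beta> = \<eta> * smin / 2 - L * \<eta>\<^sup>2 * smax\<^sup>2 / 2 - \<eta> * smax / 2 * \<alpha>"
    by (simp add: \<beta>_def beta_star_def Let_def \<eta>_def[symmetric] \<alpha>_def power2_eq_square power3_eq_cube)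
  have const: "iteration_const L smin smax = 4 * (1 + \<alpha>) / \<beta>"
    by (simp add: iteration_const_def \<alpha>_def \<beta>_def \<eta>_def)
  have "0 < iteration_const L smin smax"
    unfolding const using \<beta> \<open>0 \<le> \<alpha>\<close> by simp
  moreover have "integrable M (\<lambda>\<omega>. norm (grad (objective P F) (x (\<zeta> \<omega>) \<omega>))) \<and>
      (\<integral>\<omega>. norm (grad (objective P F) (x (\<zeta> \<omega>) \<omega>)) \<partial>M) \<le> \<epsilon>"
    if \<epsilon>: "0 < \<epsilon>" and K: "1 \<le> K" and q_def: "q = epoch_length L smin smax \<sigma>1 \<epsilon>"
      and run: "spider_sqn_run M P F x0 \<eta> q (q\<^sup>2) q m \<delta> \<gamma>0 K U \<zeta> x v"
      and hess: "hess_approx_bounded M smin smax m \<delta> \<gamma>0 K x v"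
      and large: "iteration_const L smin smax * (\<Delta> / \<epsilon>\<^sup>2) \<le> real K"
    for \<epsilon> :: real and K q and M :: "'w measure" and U \<zeta> x v
  proof -
    note q = epoch_length_bounds(1,2)[OF params problem.\<sigma>1_pos \<epsilon>,
        folded q_def \<eta>_def \<beta>_def]
    interpret spider_sqn_analysis P F L \<kappa> \<sigma>1 M x0 \<eta> q "q\<^sup>2" q m \<delta> \<gamma>0 K U \<zeta> x v smin smax
      using problem run hess bounds smax \<eta> q(1) K
      by (simp add: spider_sqn_analysis_def spider_sqn_analysis_axioms_def)
    \<comment> \<open>This summand of the squared epoch length carries the restart noise;
      multiplying out gives the quarter required by \<open>sum_grad_sq_le\<close>.\<close>
    have "\<eta> * smax / \<beta> * (2 * \<sigma>1\<^sup>2 / \<epsilon>\<^sup>2)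
        \<le> (\<eta> * smax / \<beta> + 2 + L\<^sup>2 * \<eta>^3 * smax^3 / \<beta>) * (2 * \<sigma>1\<^sup>2 / \<epsilon>\<^sup>2)"
      using \<eta> \<beta> smax by (intro mult_right_mono) auto
    also have "\<dots> \<le> (real q)\<^sup>2" by (rule q(2))
    finally have noise: "\<eta> * smax / 2 * (\<sigma>1\<^sup>2 / real (q\<^sup>2)) \<le> \<beta> * \<epsilon>\<^sup>2 / 4"
      using \<epsilon> \<beta> q(1) by (simp add: field_simps)
    \<comment> \<open>Nonnegativity of the gap and \<open>1 + \<alpha> \<ge> 1\<close> allow the
      iteration constant to be lowered to \<open>4 / \<beta>\<close>, which gives the other
      quarter.\<close>
    have "0 \<le> \<Delta>" unfolding \<Delta>_def by (rule gap_nonneg)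
    then have "4 / \<beta> * (\<Delta> / \<epsilon>\<^sup>2) \<le> iteration_const L smin smax * (\<Delta> / \<epsilon>\<^sup>2)"
      unfolding const using \<beta> \<open>0 \<le> \<alpha>\<close> by (intro mult_right_mono divide_right_mono) auto
    then have "4 / \<beta> * (\<Delta> / \<epsilon>\<^sup>2) \<le> real K" using large by (rule order_trans)
    then have gap: "\<Delta> \<le> real K * (\<beta> * \<epsilon>\<^sup>2 / 4)"
      using \<beta> \<epsilon> by (simp add: field_simps)
    have "(\<Sum>k\<in>{1..K}. grad_sq k) \<le> ennreal (real K * \<epsilon>\<^sup>2)"
      using \<beta> \<open>\<alpha> \<le> 1\<close> noise gap unfolding \<beta>_eq \<alpha>_def \<Delta>_def by (intro sum_grad_sq_le) auto
    from expected_output_grad_le[OF \<epsilon> this] show ?thesis by blast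
  qed
  moreover note sfo_complexity[OF params problem.\<sigma>1_pos]
  ultimately show ?thesis unfolding \<eta>_def \<Delta>_def by blast
qed

end
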